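(* Let $1<q<p<\infty$, and consider the mapping $F_{q,p}:\mathscr{S}(\mathbb{R})\setminus\{0\}\to\mathbb{R}_{>0}$, $$F_{q,p}(f)=\frac{\|f\|_q\,\|\hat f\|_q}{\|f\|_p\,\|\hat f\|_p}.$$ (i) If $\frac1p+\frac1q\geq 1$, then the image of $F_{q,p}$ is an infinite (i.e. unbounded) subinterval of $[1,\infty)$. (ii) If $\frac1p+\frac1q<1$, then the image of $F_{q,p}$ is $(0,\infty)$.
   Context: $\mathscr{S}(\mathbb{R})$ is the Schwartz space of (complex-valued) functions on the real line. The Fourier transform is $\hat f(\xi)=\int_{\mathbb{R}} f(x)e^{-2\pi i x\xi}\,dx$ for $f\in\mathscr{S}(\mathbb{R})$. For $1\le r<\infty$, $\|f\|_r=\big(\int_{\mathbb{R}}|f(x)|^r\,dx\big)^{1/r}$ is the $L^r$ norm. $\mathbb{R}_{>0}=(0,\infty)$. *)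

theory Defs
  imports "HOL-Analysis.Analysis"
begin

definition iter_deriv :: "nat \<Rightarrow> (real \<Rightarrow> complex) \<Rightarrow> real \<Rightarrow> complex" where
  "iter_deriv n f = ((\<lambda>g x. vector_derivative g (at x)) ^^ n) f"

definition schwartz_space :: "(real \<Rightarrow> complex) set" where
  "schwartz_space = {f. (\<forall>n x. iter_deriv n f differentiable (at x)) \<and>
     (\<forall>m n. bounded (range (\<lambda>x. x ^ m *\<^sub>R iter_deriv n f x)))}"

definition fourier :: "(real \<Rightarrow> complex) \<Rightarrow> real \<Rightarrow> complex" where
  "fourier f \<xi> =
     (\<integral>x. f x * exp (- 2 * complex_of_real pi * \<i> * complex_of_real x * complex_of_real \<xi>) \<partial>lborel)"

definition Lnorm :: "real \<Rightarrow> (real \<Rightarrow> complex) \<Rightarrow> real" where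
  "Lnorm r f = (\<integral>x. (cmod (f x)) powr r \<partial>lborel) powr (1 / r)"

definition norm_quotient :: "real \<Rightarrow> real \<Rightarrow> (real \<Rightarrow> complex) \<Rightarrow> real" where
  "norm_quotient q p f = (Lnorm q f * Lnorm q (fourier f)) / (Lnorm p f * Lnorm p (fourier f))"

end

theory Submission
  imports Defs "HOL-Complex_Analysis.Complex_Analysis" "HOL-Probability.Probability"
begin

text \<open>
  Lower bound. If \<open>1/p + 1/q \<ge> 1\<close> and \<open>q < p\<close>, then \<open>q < 2\<close> and \<open>q < p \<le> q'\<close>, where \<open>1/q + 1/q' = 1\<close>.
  Interpolating \<open>L\<^sup>p\<close> between \<open>L\<^sup>q\<close> and \<open>L\<^sup>q\<^sup>'\<close> with the same weights for \<open>f\<close> and for its transform, and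
  bounding the \<open>L\<^sup>q\<^sup>'\<close> norm of each by the \<open>L\<^sup>q\<close> norm of the other (Hausdorff--Young with
  constant 1), the product of the two inequalities is exactly \<open>F \<ge> 1\<close>. Hausdorff--Young itself is
  obtained for the discrete transform on \<open>\<int>/N\<close> by the three lines theorem, and passes to the line
  through Riemann sums with equal mesh \<open>N\<^sup>-\<^sup>1\<^sup>/\<^sup>2\<close> in position and frequency, for which the discrete
  constant cancels exactly.

  Large values. For \<open>f = exp (- \<pi> a x\<^sup>2)\<close> with \<open>Re a > 0\<close>, \<open>F\<close> is a constant times
  \<open>((Re a / |a|)\<^sup>2) powr (1/(2p) - 1/(2q))\<close>, so chirps with \<open>Re a \<rightarrow> 0\<close> and \<open>Im a = 1\<close> make it blow up.

  Small values. The self-dual function \<open>s\<^sup>-\<^sup>1\<^sup>/\<^sup>2 exp (- \<pi> x\<^sup>2/s\<^sup>2) + s\<^sup>1\<^sup>/\<^sup>2 exp (- \<pi> s\<^sup>2x\<^sup>2)\<close> has \<open>L\<^sup>r\<close> norm of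
  order \<open>s powr |1/2 - 1/r|\<close>, and \<open>|1/2 - 1/q| < 1/2 - 1/p\<close> precisely when \<open>1/p + 1/q < 1\<close>.

  The image is an interval because the segment between two linearly independent functions avoids 0.
\<close>

section \<open>Riesz--Thorin interpolation for the discrete Fourier transform\<close>

text \<open>Hadamard's theorem. Multiplying by \<open>exp (\<epsilon> * (z^2 - 1))\<close> costs
  nothing on the strip, since \<open>Re (z^2) \<le> 1\<close> there, and forces decay as
  \<open>Im z\<close> grows. The factor tends to 1 as \<open>\<epsilon>\<close> tends to 0.\<close>

lemma three_lines:
  fixes f :: "complex \<Rightarrow> complex"
  assumes holo: "f holomorphic_on UNIV"
    and bdd: "\<And>z. 0 \<le> Re z \<Longrightarrow> Re z \<le> 1 \<Longrightarrow> cmod (f z) \<le> B"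
    and left: "\<And>z. Re z = 0 \<Longrightarrow> cmod (f z) \<le> 1"
    and right: "\<And>z. Re z = 1 \<Longrightarrow> cmod (f z) \<le> 1"
    and z0: "0 \<le> Re z0" "Re z0 \<le> 1"
  shows "cmod (f z0) \<le> 1"
proof -
  have eps: "cmod (f z0) * exp (\<epsilon> * Re (z0\<^sup>2 - 1)) \<le> 1" if "\<epsilon> > 0" for \<epsilon> :: real
  proof -
    \<comment> \<open>the factor decays along the strip, so the maximum principle applies on a tall enough rectangle\<close>
    define g where "g z = f z * exp (of_real \<epsilon> * (z\<^sup>2 - 1))" for z
    \<comment> \<open>The height puts \<open>z0\<close> inside the rectangle and makes
      \<open>\<epsilon> * T^2 \<ge> \<bar>B\<bar>\<close>. With \<open>exp t \<ge> 1 + t\<close>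
      this gives \<open>\<bar>B\<bar> * exp (- \<epsilon> * T^2) \<le> 1\<close> on the horizontal
      sides.\<close>
    define T where "T = \<bar>Im z0\<bar> + sqrt (\<bar>B\<bar> / \<epsilon>)"
    define S where "S = cbox (Complex 0 (-T)) (Complex 1 T)"
    have T: "\<bar>Im z0\<bar> \<le> T" "\<bar>B\<bar> / \<epsilon> \<le> T\<^sup>2" "T \<ge> 0"
    proof -
      have "0 \<le> sqrt (\<bar>B\<bar> / \<epsilon>)" using that by simp
      then show "\<bar>Im z0\<bar> \<le> T" "T \<ge> 0" by (auto simp: T_def)
      have "\<bar>B\<bar> / \<epsilon> = (sqrt (\<bar>B\<bar> / \<epsilon>))\<^sup>2" using that by simp
      also have "\<dots> \<le> T\<^sup>2" unfolding T_def using \<open>0 \<le> sqrt (\<bar>B\<bar> / \<epsilon>)\<close> by (intro power_mono) auto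
      finally show "\<bar>B\<bar> / \<epsilon> \<le> T\<^sup>2" .
    qed
    have ng: "cmod (g z) = cmod (f z) * exp (\<epsilon> * ((Re z)\<^sup>2 - (Im z)\<^sup>2 - 1))" for z
      by (simp add: g_def norm_mult power2_eq_square)
    have small: "exp (\<epsilon> * ((Re z)\<^sup>2 - (Im z)\<^sup>2 - 1)) \<le> exp (- \<epsilon> * (Im z)\<^sup>2)"
      if "0 \<le> Re z" "Re z \<le> 1" for z
    proof -
      have "(Re z)\<^sup>2 \<le> 1" using that by (simp add: power_le_one)
      then have "\<epsilon> * ((Re z)\<^sup>2 - (Im z)\<^sup>2 - 1) \<le> \<epsilon> * (- (Im z)\<^sup>2)"
        using \<open>\<epsilon> > 0\<close> by (intro mult_left_mono) auto
      then show ?thesis by simp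
    qed
    have "cmod (g z0) \<le> 1"
    proof (rule maximum_modulus_frontier[of g S])
      show "g holomorphic_on interior S"
        unfolding g_def by (intro holomorphic_intros holomorphic_on_subset[OF holo]) auto
      show "continuous_on (closure S) g"
        unfolding g_def
        by (intro continuous_intros continuous_on_subset[OF holomorphic_on_imp_continuous_on[OF holo]]) auto
      show "bounded S" by (simp add: S_def)
      show "z0 \<in> S" using z0 T by (auto simp: S_def in_cbox_complex_iff)
      fix z assume "z \<in> frontier S"
      then have z: "0 \<le> Re z" "Re z \<le> 1"
        and "Re z = 0 \<or> Re z = 1 \<or> \<bar>Im z\<bar> = T"
        by (auto simp: S_def frontier_cbox in_cbox_complex_iff in_box_complex_iff)
      then consider "Re z = 0 \<or> Re z = 1" | "\<bar>Im z\<bar> = T" by blast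
      then show "cmod (g z) \<le> 1"
      proof cases
        case 1
        have "exp (- \<epsilon> * (Im z)\<^sup>2) \<le> 1" using \<open>\<epsilon> > 0\<close> by simp
        then have "exp (\<epsilon> * ((Re z)\<^sup>2 - (Im z)\<^sup>2 - 1)) \<le> 1" using small[OF z] by linarith
        moreover have "cmod (f z) \<le> 1" using 1 left right by blast
        ultimately show ?thesis unfolding ng by (intro mult_le_one) auto
      next
        case 2
        have "(Im z)\<^sup>2 = T\<^sup>2" using 2 by (metis power2_abs)
        then have "\<bar>B\<bar> \<le> \<epsilon> * (Im z)\<^sup>2" using T(2) \<open>\<epsilon> > 0\<close> by (simp add: field_simps)
        also have "\<dots> \<le> exp (\<epsilon> * (Im z)\<^sup>2)" using exp_ge_add_one_self[of "\<epsilon> * (Im z)\<^sup>2"] by linarith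
        finally have "\<bar>B\<bar> * exp (- \<epsilon> * (Im z)\<^sup>2) \<le> 1" by (simp add: exp_minus field_simps)
        moreover have "cmod (g z) \<le> \<bar>B\<bar> * exp (- \<epsilon> * (Im z)\<^sup>2)"
          unfolding ng using bdd[OF z] by (intro mult_mono small z) auto
        ultimately show ?thesis by linarith
      qed
    qed
    then show ?thesis by (simp add: ng power2_eq_square)
  qed
  have "((\<lambda>\<epsilon>. cmod (f z0) * exp (\<epsilon> * Re (z0\<^sup>2 - 1))) \<longlongrightarrow> cmod (f z0) * exp (0 * Re (z0\<^sup>2 - 1))) (at_right 0)"
    by (intro tendsto_intros)
  then have "cmod (f z0) * exp (0 * Re (z0\<^sup>2 - 1)) \<le> 1"
    by (rule tendsto_upperbound) (use eps in \<open>auto intro!: eventually_at_rightI[of 0 1]\<close>)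
  then show ?thesis by simp
qed

text \<open>Thorin's argument: the sequences are embedded in an analytic family. On
  \<open>Re z = 0\<close> the moduli are |w|^q, so the trivial l^1 bound applies; on
  \<open>Re z = 1\<close> they are |w|^(q/2), so \<open>L2\<close> applies. The normalization makes
  the relevant norms equal to 1 on both lines.\<close>

lemma riesz_thorin_normalized:
  fixes e :: "'a \<Rightarrow> 'b \<Rightarrow> complex"
  assumes fin: "finite J" "finite K" and e: "\<And>j k. cmod (e j k) \<le> 1" and M: "M > 0"
    and L2: "\<And>a b. cmod (\<Sum>j\<in>J. \<Sum>k\<in>K. a j * b k * e j k)
               \<le> M * sqrt (\<Sum>j\<in>J. (cmod (a j))\<^sup>2) * sqrt (\<Sum>k\<in>K. (cmod (b k))\<^sup>2)"
    and q: "1 < q" "q \<le> 2"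
    and a: "(\<Sum>j\<in>J. cmod (a j) powr q) = 1" and b: "(\<Sum>k\<in>K. cmod (b k) powr q) = 1"
  shows "cmod (\<Sum>j\<in>J. \<Sum>k\<in>K. a j * b k * e j k) \<le> M powr (2 - 2 / q)"
proof -
  \<comment> \<open>\<open>sgn w\<close> makes the junk value of \<open>ln 0\<close> harmless; \<open>F w z\<close> has modulus \<open>|w| powr (q (1 - Re z / 2))\<close>\<close>
  define F where "F w z = sgn w * exp (of_real (q * ln (cmod w)) * (1 - z / 2))" for w z :: complex
  have F: "cmod (F w z) = cmod w powr (q * (1 - Re z / 2))" for w z
  proof (cases "w = 0")
    case False
    have "Re (of_real (q * ln (cmod w)) * (1 - z / 2)) = q * (1 - Re z / 2) * ln (cmod w)"
      by simp
    then show ?thesis using False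
      by (simp only: F_def norm_mult norm_sgn powr_def norm_exp_eq_Re) simp
  qed (simp add: F_def)
  \<comment> \<open>At this point of the strip the exponent \<open>q * (1 - Re z / 2)\<close> equals
    1, so the family returns the original entries.\<close>
  have F_one: "F w (of_real (2 - 2 / q)) = w" for w
  proof (cases "w = 0")
    case False
    have "1 - complex_of_real (2 - 2 / q) / 2 = of_real (1 / q)"
      by (simp add: diff_divide_distrib)
    then have "exp (of_real (q * ln (cmod w)) * (1 - of_real (2 - 2 / q) / 2)) = exp (complex_of_real (ln (cmod w)))"
      using q by (simp only: flip: of_real_mult) simp
    also have "\<dots> = of_real (cmod w)" using False by (simp add: exp_of_real)
    finally show ?thesis using False by (simp add: F_def sgn_div_norm scaleR_conv_of_real)
  qed (simp add: F_def)
  \<comment> \<open>The factor is M^(-z): it has modulus 1 on the left line and cancels the bound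
    \<open>M\<close> on the right line.\<close>
  define \<Phi> where "\<Phi> z = exp (- z * of_real (ln M)) * (\<Sum>j\<in>J. \<Sum>k\<in>K. F (a j) z * F (b k) z * e j k)" for z
  have triv: "cmod (\<Sum>j\<in>J. \<Sum>k\<in>K. F (a j) z * F (b k) z * e j k)
       \<le> (\<Sum>j\<in>J. cmod (F (a j) z)) * (\<Sum>k\<in>K. cmod (F (b k) z))" for z
    unfolding sum_product
  proof (intro sum_norm_le)
    show "cmod (F (a j) z * F (b k) z * e j k) \<le> cmod (F (a j) z) * cmod (F (b k) z)" for j k
      using e[of j k] by (simp add: norm_mult mult_left_le)
  qed
  \<comment> \<open>A bound uniform on the strip, which supplies the boundedness required by
    \<open>three_lines\<close>; its size does not enter the result.\<close>
  define C where "C w = exp \<bar>q * ln (cmod w)\<bar>" for w :: complex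
  have FC: "cmod (F w z) \<le> C w" if "0 \<le> Re z" "Re z \<le> 1" for w z
  proof -
    have "q * ln (cmod w) * (1 - Re z / 2) \<le> \<bar>q * ln (cmod w)\<bar> * \<bar>1 - Re z / 2\<bar>"
      by (metis abs_ge_self abs_mult)
    also have "\<dots> \<le> \<bar>q * ln (cmod w)\<bar> * 1" using that by (intro mult_left_mono) auto
    finally have "q * (1 - Re z / 2) * ln (cmod w) \<le> \<bar>q * ln (cmod w)\<bar>" by (simp add: mult_ac)
    then show ?thesis unfolding F powr_def C_def by simp
  qed
  have norm_exp: "cmod (exp (- z * of_real (ln M))) = M powr (- Re z)" for z
    using M by (simp add: powr_def)
  have "cmod (\<Phi> (of_real (2 - 2 / q))) \<le> 1"
  proof (rule three_lines[where f = \<Phi> and B = "exp \<bar>ln M\<bar> * ((\<Sum>j\<in>J. C (a j)) * (\<Sum>k\<in>K. C (b k)))"])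
    show "\<Phi> holomorphic_on UNIV" unfolding \<Phi>_def F_def by (intro holomorphic_intros) auto
    show "0 \<le> Re (of_real (2 - 2 / q) :: complex)" "Re (of_real (2 - 2 / q) :: complex) \<le> 1"
      using q by (auto simp: field_simps)
  next
    fix z :: complex
    assume z: "0 \<le> Re z" "Re z \<le> 1"
    have "M powr (- Re z) \<le> exp \<bar>ln M\<bar>"
    proof -
      have "- Re z * ln M \<le> \<bar>Re z\<bar> * \<bar>ln M\<bar>" by (metis abs_ge_self abs_minus_cancel abs_mult)
      also have "\<dots> \<le> 1 * \<bar>ln M\<bar>" using z by (intro mult_right_mono) auto
      finally show ?thesis using M by (simp add: powr_def)
    qed
    moreover have "cmod (\<Sum>j\<in>J. \<Sum>k\<in>K. F (a j) z * F (b k) z * e j k) \<le> (\<Sum>j\<in>J. C (a j)) * (\<Sum>k\<in>K. C (b k))"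
      by (rule order_trans[OF triv]) (intro mult_mono sum_mono FC z sum_nonneg; simp add: C_def)
    ultimately show "cmod (\<Phi> z) \<le> exp \<bar>ln M\<bar> * ((\<Sum>j\<in>J. C (a j)) * (\<Sum>k\<in>K. C (b k)))"
      unfolding \<Phi>_def norm_mult norm_exp by (intro mult_mono) auto
  next
    fix z :: complex
    assume z: "Re z = 0"
    show "cmod (\<Phi> z) \<le> 1"
      unfolding \<Phi>_def norm_mult norm_exp using triv[of z] M by (simp add: z F a b)
  next
    fix z :: complex
    assume z: "Re z = 1"
    have sq: "(cmod (F w z))\<^sup>2 = cmod w powr q" for w
      by (simp add: F z power2_eq_square flip: powr_add)
    have "cmod (\<Sum>j\<in>J. \<Sum>k\<in>K. F (a j) z * F (b k) z * e j k) \<le> M"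
      using L2[of "\<lambda>j. F (a j) z" "\<lambda>k. F (b k) z"] by (simp add: sq a b)
    then show "cmod (\<Phi> z) \<le> 1"
      unfolding \<Phi>_def norm_mult norm_exp using M by (simp add: z powr_minus field_simps)
  qed
  then have "M powr (- (2 - 2 / q)) * cmod (\<Sum>j\<in>J. \<Sum>k\<in>K. a j * b k * e j k) \<le> 1"
    unfolding \<Phi>_def norm_mult norm_exp F_one by simp
  then show ?thesis using M by (simp only: powr_minus) (simp add: field_simps)
qed

text \<open>By homogeneity both sequences can be divided by their l^q norms. If one of these norms
  is 0, the whole form vanishes.\<close>

lemma riesz_thorin_bilinear:
  fixes e :: "'a \<Rightarrow> 'b \<Rightarrow> complex"
  assumes fin: "finite J" "finite K" and e: "\<And>j k. cmod (e j k) \<le> 1" and M: "M > 0"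
    and L2: "\<And>a b. cmod (\<Sum>j\<in>J. \<Sum>k\<in>K. a j * b k * e j k)
               \<le> M * sqrt (\<Sum>j\<in>J. (cmod (a j))\<^sup>2) * sqrt (\<Sum>k\<in>K. (cmod (b k))\<^sup>2)"
    and q: "1 < q" "q \<le> 2"
  shows "cmod (\<Sum>j\<in>J. \<Sum>k\<in>K. a j * b k * e j k) \<le> M powr (2 - 2 / q)
     * (\<Sum>j\<in>J. cmod (a j) powr q) powr (1 / q) * (\<Sum>k\<in>K. cmod (b k) powr q) powr (1 / q)"
    (is "_ \<le> _ * ?A powr _ * ?B powr _")
proof (cases "?A = 0 \<or> ?B = 0")
  case True
  then have "(\<forall>j\<in>J. a j = 0) \<or> (\<forall>k\<in>K. b k = 0)" 
    using fin by (simp add: sum_nonneg_eq_0_iff)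
  then have "(\<Sum>j\<in>J. \<Sum>k\<in>K. a j * b k * e j k) = 0" by (auto intro!: sum.neutral)
  then show ?thesis by simp
next
  case False
  moreover have "?A \<ge> 0" "?B \<ge> 0" by (auto intro: sum_nonneg)
  ultimately have pos: "?A > 0" "?B > 0" by linarith+
  define s where "s = ?A powr (1 / q)"
  define t where "t = ?B powr (1 / q)"
  have st: "s > 0" "t > 0" "s powr q = ?A" "t powr q = ?B"
    using pos q by (auto simp: s_def t_def powr_powr)
  have "cmod (\<Sum>j\<in>J. \<Sum>k\<in>K. (a j / of_real s) * (b k / of_real t) * e j k) \<le> M powr (2 - 2 / q)"
    using st pos by (intro riesz_thorin_normalized[OF fin e M L2 q]) 
      (simp_all add: norm_divide powr_divide flip: sum_divide_distrib)
  also have "(\<Sum>j\<in>J. \<Sum>k\<in>K. (a j / of_real s) * (b k / of_real t) * e j k) = 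
      (\<Sum>j\<in>J. \<Sum>k\<in>K. a j * b k * e j k) / of_real (s * t)"
    by (simp add: sum_divide_distrib)
  finally have "cmod (\<Sum>j\<in>J. \<Sum>k\<in>K. a j * b k * e j k) \<le> M powr (2 - 2 / q) * (s * t)"
    using st by (simp add: norm_divide norm_mult field_simps)
  then show ?thesis by (simp add: s_def t_def mult.assoc)
qed

section \<open>The discrete Fourier transform on Z/N\<close>

lemma sum_roots_of_unity:
  fixes d :: int and N :: nat
  assumes "\<bar>d\<bar> < int N"
  shows "(\<Sum>k<N. cis (2 * pi * d / N) ^ k) = (if d = 0 then of_nat N else 0)"
proof (cases "d = 0")
  case False
  have N: "N > 0" using assms by linarith
  let ?w = "cis (2 * pi * d / N)"
  \<comment> \<open>If the root were 1, then N would divide d, which is impossible for 0 < |d| < N.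
    The geometric sum of a nontrivial N-th root of unity is 0.\<close>
  have "?w \<noteq> 1"
  proof
    assume "?w = 1"
    then have "exp (\<i> * of_real (2 * pi * d / N)) = 1" by (simp add: cis_conv_exp)
    then obtain n :: int where "2 * pi * d / N = of_int (2 * n) * pi"
      by (auto simp: exp_eq_1)
    then have "real_of_int d = n * N" using N by (simp add: field_simps)
    then have "d = n * int N" by (metis of_int_eq_iff of_int_mult of_int_of_nat_eq)
    then have "n \<noteq> 0" "\<bar>n\<bar> * int N < int N" using False assms by (auto simp: abs_mult)
    moreover from this(1) have "1 * int N \<le> \<bar>n\<bar> * int N" by (intro mult_right_mono) auto
    ultimately show False by simp
  qed
  moreover have "?w ^ N = 1" using N
    using cis_multiple_2pi[of "real_of_int d"] by (simp add: Complex.DeMoivre mult.assoc)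
  ultimately show ?thesis using False by (simp add: geometric_sum)
qed simp

text \<open>The rows of the matrix are orthogonal with squared length N, so Parseval computes the
  l^2 norm of the transform \<open>A\<close> exactly, and Cauchy-Schwarz pairs it with
  \<open>b\<close>. The shift by \<open>L\<close>, which will center the grid at the origin,
  contributes only a phase independent of \<open>k\<close> to products of two rows.\<close>

lemma dft_L2_bound:
  fixes N L :: nat
  assumes N: "N > 0"
  defines "e \<equiv> (\<lambda>j k. cis (- 2 * pi * ((real j - L) * (real k - L) / N)))"
  shows "cmod (\<Sum>j<N. \<Sum>k<N. a j * b k * e j k)
     \<le> sqrt N * sqrt (\<Sum>j<N. (cmod (a j))\<^sup>2) * sqrt (\<Sum>k<N. (cmod (b k))\<^sup>2)"
proof -
  define A where "A k = (\<Sum>j<N. a j * e j k)" for k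
  have orth: "(\<Sum>k<N. e j k * cnj (e i k)) = (if i = j then of_nat N else 0)" if "i < N" "j < N" for i j
  proof -
    define d where "d = int i - int j"
    have "e j k * cnj (e i k) = cis (- 2 * pi * d * L / N) * cis (2 * pi * d / N) ^ k" for k
    proof -
      have "- 2 * pi * ((real j - L) * (real k - L) / N) + - (- 2 * pi * ((real i - L) * (real k - L) / N))
          = - 2 * pi * d * L / N + real k * (2 * pi * d / N)"
        using N by (simp add: d_def field_simps)
      then show ?thesis unfolding e_def by (simp only: cis_cnj Complex.DeMoivre cis_mult)
    qed
    then have "(\<Sum>k<N. e j k * cnj (e i k)) = cis (- 2 * pi * d * L / N) * (\<Sum>k<N. cis (2 * pi * d / N) ^ k)"
      by (simp add: sum_distrib_left)
    also have "\<dots> = (if i = j then of_nat N else 0)"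
      by (subst sum_roots_of_unity) (use that in \<open>auto simp: d_def\<close>)
    finally show ?thesis .
  qed
  have "complex_of_real (\<Sum>k<N. (cmod (A k))\<^sup>2) = (\<Sum>k<N. A k * cnj (A k))"
    unfolding of_real_sum complex_norm_square ..
  also have "\<dots> = (\<Sum>k<N. \<Sum>j<N. \<Sum>i<N. a j * cnj (a i) * (e j k * cnj (e i k)))"
    by (simp add: A_def sum_product mult_ac)
  also have "\<dots> = (\<Sum>j<N. \<Sum>i<N. \<Sum>k<N. a j * cnj (a i) * (e j k * cnj (e i k)))"
    by (rule trans[OF sum.swap], intro sum.cong refl sum.swap)
  also have "\<dots> = (\<Sum>j<N. \<Sum>i<N. a j * cnj (a i) * (if i = j then of_nat N else 0))"
    by (intro sum.cong refl) (simp add: orth flip: sum_distrib_left)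
  also have "\<dots> = (\<Sum>j<N. a j * cnj (a j) * of_nat N)"
    by (intro sum.cong refl) (simp add: if_distrib[of "\<lambda>x. _ * x"] sum.delta' cong: if_cong)
  also have "\<dots> = complex_of_real (N * (\<Sum>j<N. (cmod (a j))\<^sup>2))"
    unfolding of_real_mult of_real_sum complex_norm_square by (simp add: sum_distrib_left mult_ac)
  finally have A: "(\<Sum>k<N. (cmod (A k))\<^sup>2) = N * (\<Sum>j<N. (cmod (a j))\<^sup>2)"
    by (simp only: of_real_eq_iff)
  have "(\<Sum>j<N. \<Sum>k<N. a j * b k * e j k) = (\<Sum>k<N. A k * b k)"
    by (subst sum.swap) (simp add: A_def sum_distrib_left sum_distrib_right mult_ac)
  also have "cmod \<dots> \<le> (\<Sum>k<N. \<bar>cmod (A k)\<bar> * \<bar>cmod (b k)\<bar>)"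
    by (intro sum_norm_le) (simp add: norm_mult)
  also have "\<dots> \<le> L2_set (\<lambda>k. cmod (A k)) {..<N} * L2_set (\<lambda>k. cmod (b k)) {..<N}"
    by (rule L2_set_mult_ineq)
  also have "\<dots> = sqrt N * sqrt (\<Sum>j<N. (cmod (a j))\<^sup>2) * sqrt (\<Sum>k<N. (cmod (b k))\<^sup>2)"
    by (simp add: L2_set_def A real_sqrt_mult)
  finally show ?thesis .
qed

text \<open>Interpolation with M = sqrt N. Pairing with \<open>b\<close> in l^q is the dual way of
  measuring the transform of \<open>a\<close> in the conjugate exponent.\<close>

lemma dft_hausdorff_young:
  fixes N L :: nat
  assumes N: "N > 0" and q: "1 < q" "q \<le> 2"
  shows "cmod (\<Sum>j<N. \<Sum>k<N. a j * b k * cis (- 2 * pi * ((real j - L) * (real k - L) / N)))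
     \<le> N powr (1 - 1 / q) * (\<Sum>j<N. cmod (a j) powr q) powr (1 / q) * (\<Sum>k<N. cmod (b k) powr q) powr (1 / q)"
proof -
  have "sqrt N powr (2 - 2 / q) = N powr (1 - 1 / q)"
    using N by (simp add: powr_half_sqrt[symmetric] powr_powr algebra_simps diff_divide_distrib)
  then show ?thesis
    using riesz_thorin_bilinear[OF _ _ _ _ dft_L2_bound[OF N] q, of L a b] N by simp
qed

section \<open>Continuous functions of quadratic decay\<close>

text \<open>A working class larger than the Schwartz space: it suffices for integrability, Riemann
  sums and inversion, and for Schwartz \<open>f\<close> it is easily checked for
  \<open>fourier f\<close>, so that invariance of the full Schwartz space under the transform need
  not be established.\<close>

definition decaying :: "(real \<Rightarrow> complex) \<Rightarrow> bool" where
  "decaying f \<longleftrightarrow> continuous_on UNIV f \<and> (\<exists>C. \<forall>x. cmod (f x) \<le> C / (1 + x\<^sup>2))"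

lemma one_plus_square_pos: "0 < 1 + (x::real)\<^sup>2"
  by (simp add: add_pos_nonneg)

lemma decay_constant_nonneg: "norm (f (0::real)) \<le> C / (1 + 0\<^sup>2) \<Longrightarrow> 0 \<le> (C::real)"
  by (simp add: order_trans[OF norm_ge_zero])

lemma decayingI:
  "continuous_on UNIV f \<Longrightarrow> (\<And>x. cmod (f x) \<le> C / (1 + x\<^sup>2)) \<Longrightarrow> decaying f"
  unfolding decaying_def by blast

lemma decaying_continuous: "decaying f \<Longrightarrow> continuous_on UNIV f"
  unfolding decaying_def by blast

lemma decaying_borel: "decaying f \<Longrightarrow> f \<in> borel_measurable borel"
  by (intro borel_measurable_continuous_onI decaying_continuous)

lemma decayingE:
  assumes "decaying f"
  obtains C where "C \<ge> 0" "\<And>x. cmod (f x) \<le> C / (1 + x\<^sup>2)"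
  using assms decay_constant_nonneg unfolding decaying_def by metis

lemma decay_le_const: "C \<ge> 0 \<Longrightarrow> C / (1 + (x::real)\<^sup>2) \<le> C"
  using mult_left_mono[of 1 "1 + x\<^sup>2" C] one_plus_square_pos[of x] by (simp add: divide_le_eq)

lemma decayingE_bounded:
  assumes "decaying f"
  obtains C where "C \<ge> 0" "\<And>x. cmod (f x) \<le> C"
  using assms by (elim decayingE) (meson decay_le_const order_trans)

lemma integrable_decay_bound: "integrable lborel (\<lambda>x::real. C / (1 + x\<^sup>2))"
proof -
  have "integrable lborel (\<lambda>x::real. C * inverse (1 + x\<^sup>2))"
    using integrable_inverse_1_plus_square by (simp add: set_integrable_def)
  then show ?thesis by (simp add: divide_inverse)
qed

lemma integrable_of_decay:
  fixes f :: "real \<Rightarrow> 'a::{banach, second_countable_topology}"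
  assumes "f \<in> borel_measurable borel" "\<And>x. norm (f x) \<le> C / (1 + x\<^sup>2)"
  shows "integrable lborel f"
proof (rule Bochner_Integration.integrable_bound[OF integrable_decay_bound[of C]])
  show "AE x in lborel. norm (f x) \<le> norm (C / (1 + x\<^sup>2))"
    using assms(2) by (intro AE_I2) (metis abs_ge_self order_trans real_norm_def)
qed (use assms in simp)

lemma decaying_integrable: "decaying f \<Longrightarrow> integrable lborel f"
  using decaying_borel integrable_of_decay by (metis decayingE)

lemma decaying_dominated:
  assumes "decaying f" "continuous_on UNIV g" "\<And>x. cmod (g x) \<le> K * cmod (f x)"
  shows "decaying g"
proof -
  obtain C where C: "C \<ge> 0" "\<And>x. cmod (f x) \<le> C / (1 + x\<^sup>2)" using decayingE[OF assms(1)] by metis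
  have "cmod (g x) \<le> \<bar>K\<bar> * C / (1 + x\<^sup>2)" for x
  proof -
    have "cmod (g x) \<le> \<bar>K\<bar> * cmod (f x)"
      using assms(3)[of x] by (meson abs_ge_self mult_right_mono norm_ge_zero order_trans)
    also have "\<dots> \<le> \<bar>K\<bar> * (C / (1 + x\<^sup>2))" by (intro mult_left_mono C) auto
    finally show ?thesis by simp
  qed
  then show ?thesis using assms(2) by (rule decayingI[rotated])
qed

lemma decaying_add: "decaying f \<Longrightarrow> decaying g \<Longrightarrow> decaying (\<lambda>x. f x + g x)"
proof -
  assume f: "decaying f" and g: "decaying g"
  obtain C D where "\<And>x. cmod (f x) \<le> C / (1 + x\<^sup>2)" "\<And>x. cmod (g x) \<le> D / (1 + x\<^sup>2)"
    using f g by (metis decayingE)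
  then have "cmod (f x + g x) \<le> (C + D) / (1 + x\<^sup>2)" for x
    unfolding add_divide_distrib by (meson add_mono norm_triangle_ineq order_trans)
  then show ?thesis
    by (rule decayingI[rotated]) (intro continuous_intros decaying_continuous f g)
qed

lemma decaying_cmult: "decaying f \<Longrightarrow> decaying (\<lambda>x. c * f x)"
  using continuous_on_mult_left[OF decaying_continuous]
  by (auto intro: decaying_dominated[of f _ "cmod c"] simp: norm_mult)

text \<open>Since \<open>1 + x^2 \<ge> 1\<close>, raising it to a power \<open>r \<ge> 1\<close>
  only increases it, so the quadratic decay survives.\<close>

lemma powr_decay:
  assumes "C \<ge> 0" "norm y \<le> C / (1 + x\<^sup>2)" "r \<ge> 1"
  shows "norm y powr r \<le> C powr r / (1 + x\<^sup>2)"
proof (cases "norm y = 0")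
  case False
  have "norm y powr r \<le> (C / (1 + x\<^sup>2)) powr r"
    using assms by (intro powr_mono2) auto
  also have "\<dots> = C powr r / (1 + x\<^sup>2) powr r"
    using assms one_plus_square_pos[of x] by (simp add: powr_divide)
  also have "\<dots> \<le> C powr r / (1 + x\<^sup>2)"
  proof (intro divide_left_mono)
    show "1 + x\<^sup>2 \<le> (1 + x\<^sup>2) powr r" using powr_mono[OF assms(3), of "1 + x\<^sup>2"] by simp
  qed (use one_plus_square_pos[of x] in \<open>auto intro!: mult_pos_pos\<close>)
  finally show ?thesis .
qed (use one_plus_square_pos[of x] in simp)

lemma continuous_on_norm_powr:
  assumes "continuous_on S f" "r > 0"
  shows "continuous_on S (\<lambda>x. norm (f x) powr r)"
  using assms by (intro continuous_on_powr' continuous_intros) auto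

lemma decaying_powr_integrable:
  assumes "decaying f" "r \<ge> 1"
  shows "integrable lborel (\<lambda>x. cmod (f x) powr r)"
proof -
  obtain C where C: "C \<ge> 0" "\<And>x. cmod (f x) \<le> C / (1 + x\<^sup>2)" using decayingE[OF assms(1)] by metis
  show ?thesis
    using assms powr_decay[OF C(1) C(2) assms(2)] by (intro integrable_of_decay[where C = "C powr r"]
      borel_measurable_continuous_onI continuous_on_norm_powr decaying_continuous) auto
qed

text \<open>By continuity the integrand stays above half its value at \<open>x0\<close> on a short
  interval, which already contributes a positive amount.\<close>

lemma integral_powr_pos:
  assumes f: "decaying f" and r: "r \<ge> 1" and nz: "f x0 \<noteq> 0"
  shows "0 < (\<integral>x. cmod (f x) powr r \<partial>lborel)"
proof -
  let ?h = "\<lambda>x. cmod (f x) powr r"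
  define c where "c = ?h x0 / 2"
  have c: "c > 0" using nz by (simp add: c_def)
  have "isCont ?h x0"
    using continuous_on_norm_powr[OF decaying_continuous[OF f], of r] r
    by (simp add: continuous_on_eq_continuous_at)
  then obtain d where d: "d > 0" "\<And>x. \<bar>x - x0\<bar> < d \<Longrightarrow> \<bar>?h x - ?h x0\<bar> < c"
    using c unfolding continuous_at_eps_delta dist_real_def by blast
  have "0 < (\<integral>x. indicator {x0..<x0 + d} x *\<^sub>R c \<partial>lborel)"
    using c d by simp
  also have "\<dots> \<le> (\<integral>x. ?h x \<partial>lborel)"
  proof (rule integral_mono)
    show "integrable lborel (\<lambda>x. indicator {x0..<x0 + d} x *\<^sub>R c)"
      using d by (intro integrable_scaleR_left integrable_real_indicator) auto
    show "indicator {x0..<x0 + d} x *\<^sub>R c \<le> ?h x" for x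
      using abs_le_D2[OF less_imp_le[OF d(2)[of x]]] by (auto simp: indicator_def c_def)
  qed (rule decaying_powr_integrable[OF f r])
  finally show ?thesis .
qed

lemma Lnorm_pos: "decaying f \<Longrightarrow> r \<ge> 1 \<Longrightarrow> f x0 \<noteq> 0 \<Longrightarrow> 0 < Lnorm r f"
  using integral_powr_pos[of f r x0] by (simp add: Lnorm_def)

section \<open>Riemann sums and the Hausdorff--Young inequality\<close>

text \<open>For j < N = 4m^2 these are the points of mesh h = 1/(2m) in [-m, m). Thus h = N^(-1/2),
  and with L = 2m^2 the product of two grid points is (j - L)(k - L)/N, exactly the phase of the
  discrete transform.\<close>

definition grid :: "nat \<Rightarrow> nat \<Rightarrow> real" where
  "grid m j = (real j - 2 * (real m)\<^sup>2) / (2 * real m)"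

text \<open>For \<open>m > 0\<close>, the largest multiple of the mesh not exceeding
  \<open>x\<close>; it turns Riemann sums into integrals of step functions.\<close>

definition grid_floor :: "nat \<Rightarrow> real \<Rightarrow> real" where
  "grid_floor m x = of_int \<lfloor>2 * real m * x\<rfloor> / (2 * real m)"

lemma grid_floor_dist:
  assumes "m > 0"
  shows "\<bar>grid_floor m x - x\<bar> \<le> 1 / (2 * real m)"
proof -
  have "\<bar>of_int \<lfloor>2 * real m * x\<rfloor> - 2 * real m * x\<bar> \<le> 1" by linarith
  then have "\<bar>of_int \<lfloor>2 * real m * x\<rfloor> - 2 * real m * x\<bar> / (2 * real m) \<le> 1 / (2 * real m)"
    by (intro divide_right_mono) auto
  also have "\<bar>of_int \<lfloor>2 * real m * x\<rfloor> - 2 * real m * x\<bar> / (2 * real m) = \<bar>grid_floor m x - x\<bar>"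
    using assms by (simp add: grid_floor_def field_simps flip: abs_divide)
  finally show ?thesis .
qed

lemma grid_floor_tendsto: "(\<lambda>m. grid_floor m x) \<longlonglongrightarrow> x"
proof (rule LIM_zero_cancel, rule Lim_null_comparison)
  show "\<forall>\<^sub>F m in sequentially. norm (grid_floor m x - x) \<le> 1 / (2 * real m)"
    using grid_floor_dist by (intro eventually_sequentiallyI[of 1]) auto
  show "(\<lambda>m. 1 / (2 * real m)) \<longlonglongrightarrow> 0" by real_asymp
qed

lemma grid_floor_eq_iff:
  assumes "m > 0"
  shows "grid_floor m x = grid m j \<longleftrightarrow> x \<in> {grid m j ..< grid m j + 1 / (2 * real m)}"
proof -
  have "grid_floor m x = grid m j \<longleftrightarrow> of_int \<lfloor>2 * real m * x\<rfloor> = (of_int (int j - 2 * (int m)\<^sup>2) :: real)"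
    using assms by (simp add: grid_floor_def grid_def)
  also have "\<dots> \<longleftrightarrow> \<lfloor>2 * real m * x\<rfloor> = int j - 2 * (int m)\<^sup>2"
    by (rule of_int_eq_iff)
  also have "\<dots> \<longleftrightarrow> x \<in> {grid m j ..< grid m j + 1 / (2 * real m)}"
  proof -
    have "2 * real m * x < real j - 2 * (real m)\<^sup>2 + 1 \<longleftrightarrow> x < grid m j + 1 / (2 * real m)"
      "real j - 2 * (real m)\<^sup>2 \<le> 2 * real m * x \<longleftrightarrow> grid m j \<le> x"
      using assms by (simp_all add: grid_def field_simps)
    then show ?thesis by (simp add: floor_eq_iff)
  qed
  finally show ?thesis .
qed

lemma inj_grid: "m > 0 \<Longrightarrow> grid m i = grid m j \<longleftrightarrow> i = j"
  by (simp add: grid_def)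

lemma ex_grid_floor:
  assumes "m > 0" "- real m \<le> x" "x < real m"
  shows "\<exists>j<4 * m\<^sup>2. grid_floor m x = grid m j"
proof -
  define k where "k = \<lfloor>2 * real m * x\<rfloor> + 2 * (int m)\<^sup>2"
  have sq: "real_of_int (2 * (int m)\<^sup>2) = 2 * real m * real m" by (simp add: power2_eq_square)
  have "2 * real m * (- real m) \<le> 2 * real m * x" using assms by (intro mult_left_mono) auto
  then have "real_of_int (- (2 * (int m)\<^sup>2)) \<le> 2 * real m * x" unfolding of_int_minus sq by simp
  then have k0: "k \<ge> 0" unfolding le_floor_iff[symmetric] k_def by linarith
  have "2 * real m * x < 2 * real m * real m" using assms by (intro mult_strict_left_mono) auto
  then have "\<lfloor>2 * real m * x\<rfloor> < 2 * (int m)\<^sup>2" unfolding floor_less_iff sq .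
  then have "k < 4 * (int m)\<^sup>2" by (simp add: k_def)
  then have "nat k < 4 * m\<^sup>2" using k0 by (simp add: nat_less_iff)
  moreover have "grid_floor m x = grid m (nat k)"
    using k0 by (simp add: grid_floor_def grid_def k_def)
  ultimately show ?thesis by blast
qed

text \<open>Rounding moves \<open>x\<close> by at most 1/2, and (2y - x)^2 \<ge> 0 gives x^2 \<le>
  2y^2 + 2(y - x)^2. The factor 2 is independent of \<open>m\<close>, so one function dominates all
  the step functions.\<close>

lemma decay_grid_floor:
  assumes "m > 0" "C \<ge> 0"
  shows "C / (1 + (grid_floor m x)\<^sup>2) \<le> 2 * C / (1 + x\<^sup>2)"
proof -
  define y where "y = grid_floor m x"
  have "\<bar>y - x\<bar> \<le> 1 / (2 * real m)" unfolding y_def by (rule grid_floor_dist[OF assms(1)])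
  also have "\<dots> \<le> 1 / 2" using assms by simp
  finally have "(y - x)\<^sup>2 \<le> (1/2)\<^sup>2" by (metis abs_le_square_iff abs_of_nonneg zero_le_divide_1_iff zero_le_numeral)
  then have "x\<^sup>2 \<le> 2 * y\<^sup>2 + 1 / 2" using zero_le_power2[of "2 * y - x"] 
    by (simp add: power2_eq_square algebra_simps)
  then have "1 + x\<^sup>2 \<le> 2 * (1 + y\<^sup>2)" by simp
  then have "C * (1 + x\<^sup>2) \<le> C * (2 * (1 + y\<^sup>2))" using assms by (intro mult_left_mono) auto
  then show ?thesis unfolding y_def[symmetric] 
    using one_plus_square_pos[of x] one_plus_square_pos[of y] by (simp add: divide_simps mult_ac)
qed

text \<open>The sum is the integral of a step function that equals
  \<open>\<phi> m (grid_floor m x)\<close> on [-m, m) and 0 outside, so dominated convergence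
  applies. The summand may depend on \<open>m\<close>, which allows an inner Riemann sum to appear
  in it.\<close>

lemma riemann_sum_dominated:
  fixes \<phi> :: "nat \<Rightarrow> real \<Rightarrow> 'a::{banach, second_countable_topology}"
  assumes meas: "\<Phi> \<in> borel_measurable borel"
    and conv: "\<And>x. (\<lambda>m. \<phi> m (grid_floor m x)) \<longlonglongrightarrow> \<Phi> x"
    and bound: "\<And>m y. norm (\<phi> m y) \<le> C / (1 + y\<^sup>2)" and C: "C \<ge> 0"
  shows "(\<lambda>m. \<Sum>j<4 * m\<^sup>2. (1 / (2 * real m)) *\<^sub>R \<phi> m (grid m j)) \<longlonglongrightarrow> (\<integral>x. \<Phi> x \<partial>lborel)"
proof -
  define s where "s m x = (\<Sum>j<4 * m\<^sup>2. indicator {grid m j ..< grid m j + 1 / (2 * real m)} x *\<^sub>R \<phi> m (grid m j))" for m x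
  have s_meas: "s m \<in> borel_measurable lborel" for m
    unfolding s_def by measurable
  have s_int: "(\<integral>x. s m x \<partial>lborel) = (\<Sum>j<4 * m\<^sup>2. (1 / (2 * real m)) *\<^sub>R \<phi> m (grid m j))" for m
    unfolding s_def by (subst Bochner_Integration.integral_sum) (auto intro!: integrable_scaleR_left integrable_real_indicator)
  have s_eq: "s m x = \<phi> m (grid_floor m x)" if m: "m > 0" and j: "j < 4 * m\<^sup>2" "grid_floor m x = grid m j" for m x j
  proof -
    have "x \<in> {grid m i ..< grid m i + 1 / (2 * real m)} \<longleftrightarrow> i = j" for i
      unfolding grid_floor_eq_iff[OF m, symmetric] j(2) by (simp only: inj_grid[OF m] eq_commute)
    then have "s m x = (\<Sum>i<4 * m\<^sup>2. if i = j then \<phi> m (grid m i) else 0)"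
      unfolding s_def indicator_def of_bool_def by (intro sum.cong refl) simp
    also have "\<dots> = \<phi> m (grid m j)" using j by simp
    finally show ?thesis using j by simp
  qed
  have s_bound: "norm (s m x) \<le> 2 * C / (1 + x\<^sup>2)" for m x
  proof (cases "m > 0 \<and> (\<exists>j<4 * m\<^sup>2. grid_floor m x = grid m j)")
    case True
    then have "s m x = \<phi> m (grid_floor m x)" using s_eq by blast
    then show ?thesis using bound decay_grid_floor[OF _ C] True by (metis order_trans)
  next
    \<comment> \<open>Either \<open>m = 0\<close> and the sum is empty, or \<open>x\<close> lies in
      no grid cell and every indicator vanishes.\<close>
    case False
    then have "s m x = 0"
      unfolding s_def indicator_def of_bool_def
      by (cases "m > 0") (auto intro!: sum.neutral simp del: atLeastLessThan_iff simp flip: grid_floor_eq_iff)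
    then show ?thesis using C one_plus_square_pos[of x] by simp
  qed
  have "(\<lambda>m. \<integral>x. s m x \<partial>lborel) \<longlonglongrightarrow> (\<integral>x. \<Phi> x \<partial>lborel)"
  proof (rule integral_dominated_convergence[where w = "\<lambda>x. 2 * C / (1 + x\<^sup>2)"])
    have "(\<lambda>m. s m x) \<longlonglongrightarrow> \<Phi> x" for x
    proof (rule Lim_transform_eventually[OF conv])
      obtain M :: nat where M: "\<bar>x\<bar> < real M" using reals_Archimedean2 by blast
      show "\<forall>\<^sub>F m in sequentially. \<phi> m (grid_floor m x) = s m x"
      proof (rule eventually_sequentiallyI[of M])
        fix m assume "M \<le> m"
        then have m: "m > 0" "- real m \<le> x" "x < real m" using M by auto
        then show "\<phi> m (grid_floor m x) = s m x" using ex_grid_floor[OF m] s_eq[OF m(1)] by metis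
      qed
    qed
    then show "AE x in lborel. (\<lambda>m. s m x) \<longlonglongrightarrow> \<Phi> x" by simp
  qed (use s_meas meas s_bound integrable_decay_bound[of "2 * C"] in auto)
  then show ?thesis by (simp add: s_int)
qed

section \<open>Fourier integrals of decaying functions and Hausdorff-Young\<close>

lemma fourier_cis: "fourier f \<xi> = (\<integral>x. f x * cis (- 2 * pi * (x * \<xi>)) \<partial>lborel)"
proof -
  have "- 2 * of_real pi * \<i> * of_real x * of_real \<xi> = \<i> * of_real (- 2 * pi * (x * \<xi>))" for x
    by simp
  then show ?thesis unfolding fourier_def cis_conv_exp by (simp only:)
qed

lemma fourier_integrable: "decaying f \<Longrightarrow> integrable lborel (\<lambda>x. f x * cis (- 2 * pi * (x * \<xi>)))"
proof (rule decaying_integrable, rule decaying_dominated[of f _ 1])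
  assume "decaying f"
  then show "continuous_on UNIV (\<lambda>x. f x * cis (- 2 * pi * (x * \<xi>)))"
    by (intro continuous_intros decaying_continuous)
qed (auto simp: norm_mult)

lemma fourier_continuous:
  assumes f: "decaying f"
  shows "continuous_on UNIV (fourier f)"
  unfolding continuous_on_sequentially comp_def
proof safe
  fix X :: "nat \<Rightarrow> real" and a assume "X \<longlonglongrightarrow> a"
  then show "(\<lambda>n. fourier f (X n)) \<longlonglongrightarrow> fourier f a" unfolding fourier_cis
  proof (intro integral_dominated_convergence[where w = "\<lambda>x. cmod (f x)"] AE_I2 tendsto_intros)
    show "(\<lambda>x. f x * cis (- 2 * pi * (x * a))) \<in> borel_measurable lborel"
      "(\<lambda>x. f x * cis (- 2 * pi * (x * X n))) \<in> borel_measurable lborel" for n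
      using borel_measurable_integrable[OF fourier_integrable[OF f]] by auto
  qed (auto simp: norm_mult intro!: decaying_integrable f)
qed

text \<open>Hausdorff-Young in dual form. The double integral is a limit of double sums over the
  same grid in position and frequency, to which the bound on Z/N applies. As N = h^(-2), the
  constant h^2 N^(1 - 1/q) equals h^(2/q), just the weight needed to turn the two l^q norms into
  Riemann sums.\<close>

lemma fourier_bilinear_bound:
  assumes f: "decaying f" and g: "decaying g" and q: "1 < q" "q \<le> 2"
  shows "cmod (\<integral>\<xi>. fourier f \<xi> * g \<xi> \<partial>lborel) \<le> Lnorm q f * Lnorm q g"
proof -
  define h where "h m = 1 / (2 * real m)" for m
  define inner where "inner m y = (\<Sum>j<4 * m\<^sup>2. h m *\<^sub>R (f (grid m j) * cis (- 2 * pi * (grid m j * y))))" for m y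
  obtain Cf where Cf: "Cf \<ge> 0" "\<And>x. cmod (f x) \<le> Cf / (1 + x\<^sup>2)" using decayingE[OF f] by metis
  obtain Cg where Cg: "Cg \<ge> 0" "\<And>x. cmod (g x) \<le> Cg / (1 + x\<^sup>2)" using decayingE[OF g] by metis
  have cont: "(\<lambda>m. u (grid_floor m x)) \<longlonglongrightarrow> u x" if "decaying u" for u x
    using grid_floor_tendsto decaying_continuous[OF that]
    by (metis continuous_on_eq_continuous_at isCont_tendsto_compose open_UNIV UNIV_I)
  have inner_lim: "(\<lambda>m. inner m (grid_floor m \<xi>)) \<longlonglongrightarrow> fourier f \<xi>" for \<xi>
    unfolding inner_def h_def fourier_cis
  proof (rule riemann_sum_dominated[where C = Cf])
    show "(\<lambda>x. f x * cis (- 2 * pi * (x * \<xi>))) \<in> borel_measurable borel"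
      using borel_measurable_integrable[OF fourier_integrable[OF f]] by simp
    show "(\<lambda>m. f (grid_floor m x) * cis (- 2 * pi * (grid_floor m x * grid_floor m \<xi>)))
          \<longlonglongrightarrow> f x * cis (- 2 * pi * (x * \<xi>))" for x
      by (intro tendsto_intros cont f grid_floor_tendsto)
  qed (use Cf in \<open>auto simp: norm_mult\<close>)
  have "(\<lambda>m. \<Sum>j<4 * m\<^sup>2. (1 / (2 * real m)) *\<^sub>R cmod (f (grid m j))) \<longlonglongrightarrow> (\<integral>x. cmod (f x) \<partial>lborel)"
    using Cf by (intro riemann_sum_dominated[where C = Cf] tendsto_norm cont f
      borel_measurable_continuous_onI continuous_intros decaying_continuous) auto
  \<comment> \<open>A convergent sequence is bounded, so the inner sums are bounded uniformly in
    \<open>m\<close> and in the frequency; this lets the decay of \<open>g\<close> dominate the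
    outer sum.\<close>
  from convergent_imp_Bseq[OF convergentI[OF this]]
  obtain D where D: "\<And>m. norm (\<Sum>j<4 * m\<^sup>2. h m *\<^sub>R cmod (f (grid m j))) \<le> D"
    unfolding Bseq_def h_def by blast
  have inner_bound: "cmod (inner m y) \<le> D" for m y
  proof -
    have "cmod (inner m y) \<le> (\<Sum>j<4 * m\<^sup>2. h m *\<^sub>R cmod (f (grid m j)))"
      unfolding inner_def by (rule sum_norm_le) (simp add: norm_mult h_def)
    also have "\<dots> \<le> D" using D[of m] by (simp add: real_norm_def)
    finally show ?thesis .
  qed
  have D0: "D \<ge> 0" using inner_bound[of 0 0] norm_ge_zero order_trans by blast
  have lhs: "(\<lambda>m. \<Sum>k<4 * m\<^sup>2. h m *\<^sub>R (inner m (grid m k) * g (grid m k))) \<longlonglongrightarrow> (\<integral>\<xi>. fourier f \<xi> * g \<xi> \<partial>lborel)"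
    unfolding h_def
  proof (rule riemann_sum_dominated[where C = "D * Cg"])
    show "(\<lambda>\<xi>. fourier f \<xi> * g \<xi>) \<in> borel_measurable borel"
      by (intro borel_measurable_times borel_measurable_continuous_onI fourier_continuous decaying_continuous f g)
    show "(\<lambda>m. inner m (grid_floor m x) * g (grid_floor m x)) \<longlonglongrightarrow> fourier f x * g x" for x
      by (intro tendsto_intros inner_lim cont g)
    show "cmod (inner m y * g y) \<le> D * Cg / (1 + y\<^sup>2)" for m y
      using mult_mono[OF inner_bound[of m y] Cg(2)[of y]] D0 by (simp add: norm_mult)
  qed (use D0 Cg in auto)
  have norms: "(\<lambda>m. (\<Sum>j<4 * m\<^sup>2. h m *\<^sub>R (cmod (u (grid m j)) powr q)) powr (1 / q)) \<longlonglongrightarrow> Lnorm q u"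
    if u: "decaying u" for u
  proof -
    obtain C where C: "C \<ge> 0" "\<And>x. cmod (u x) \<le> C / (1 + x\<^sup>2)" using decayingE[OF u] by metis
    have "(\<lambda>m. \<Sum>j<4 * m\<^sup>2. (1 / (2 * real m)) *\<^sub>R (cmod (u (grid m j)) powr q)) \<longlonglongrightarrow> (\<integral>x. cmod (u x) powr q \<partial>lborel)"
    proof (rule riemann_sum_dominated[where C = "C powr q"])
      show "(\<lambda>x. cmod (u x) powr q) \<in> borel_measurable borel"
        using q by (intro borel_measurable_continuous_onI continuous_on_norm_powr decaying_continuous u) auto
      show "(\<lambda>m. cmod (u (grid_floor m x)) powr q) \<longlonglongrightarrow> cmod (u x) powr q" for x
        using q by (intro tendsto_powr' tendsto_norm cont u tendsto_const) auto
      show "norm (cmod (u y) powr q) \<le> C powr q / (1 + y\<^sup>2)" for y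
        using powr_decay[OF C(1) C(2)] q by simp
    qed auto
    then show ?thesis unfolding Lnorm_def h_def
      using q by (intro tendsto_powr' tendsto_const) (auto intro!: always_eventually sum_nonneg)
  qed
  have ineq: "cmod (\<Sum>k<4 * m\<^sup>2. h m *\<^sub>R (inner m (grid m k) * g (grid m k)))
     \<le> (\<Sum>j<4 * m\<^sup>2. h m *\<^sub>R (cmod (f (grid m j)) powr q)) powr (1 / q)
      * (\<Sum>j<4 * m\<^sup>2. h m *\<^sub>R (cmod (g (grid m j)) powr q)) powr (1 / q)" if m: "m > 0" for m
  proof -
    define N where "N = 4 * m\<^sup>2"
    define L where "L = 2 * m\<^sup>2"
    \<comment> \<open>Weighting the samples by h^(1/q) makes the q-th powers in their l^q norms
      carry the mesh factor h.\<close>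
    define c where "c = h m powr (1 / q)"
    have h: "h m > 0" using m by (simp add: h_def)
    have hN: "h m * h m * N = 1" using m by (simp add: h_def N_def power2_eq_square)
    have N: "N > 0" using m by (simp add: N_def)
    have c: "c \<ge> 0" "c powr q = h m" using h q by (simp_all add: c_def powr_powr)
    have cis: "cis (- 2 * pi * ((real j - L) * (real k - L) / N)) = cis (- 2 * pi * (grid m j * grid m k))" for j k
      using m by (simp add: grid_def L_def N_def power2_eq_square)
    have nrm: "(\<Sum>j<N. cmod (c *\<^sub>R u (grid m j)) powr q) = (\<Sum>j<N. h m *\<^sub>R (cmod (u (grid m j)) powr q))" for u :: "real \<Rightarrow> complex"
      using c by (simp add: powr_mult)
    have "cmod (\<Sum>j<N. \<Sum>k<N. (c *\<^sub>R f (grid m j)) * (c *\<^sub>R g (grid m k)) * cis (- 2 * pi * ((real j - L) * (real k - L) / N)))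
      \<le> N powr (1 - 1 / q) * (\<Sum>j<N. cmod (c *\<^sub>R f (grid m j)) powr q) powr (1 / q)
          * (\<Sum>k<N. cmod (c *\<^sub>R g (grid m k)) powr q) powr (1 / q)"
      by (rule dft_hausdorff_young[OF N q])
    also have "(\<Sum>j<N. \<Sum>k<N. (c *\<^sub>R f (grid m j)) * (c *\<^sub>R g (grid m k)) * cis (- 2 * pi * ((real j - L) * (real k - L) / N)))
       = (c * c) *\<^sub>R (\<Sum>j<N. \<Sum>k<N. f (grid m j) * g (grid m k) * cis (- 2 * pi * (grid m j * grid m k)))"
      unfolding cis by (simp add: scaleR_sum_right)
    finally have *: "c * c * cmod (\<Sum>j<N. \<Sum>k<N. f (grid m j) * g (grid m k) * cis (- 2 * pi * (grid m j * grid m k)))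
       \<le> N powr (1 - 1 / q) * (\<Sum>j<N. h m *\<^sub>R (cmod (f (grid m j)) powr q)) powr (1 / q)
          * (\<Sum>k<N. h m *\<^sub>R (cmod (g (grid m k)) powr q)) powr (1 / q)" (is "_ * ?S \<le> _ * ?F * ?G")
      unfolding nrm unfolding norm_scaleR using c(1) by simp
    \<comment> \<open>The complementary part of the mesh: \<open>h m = t * c\<close>, and t^2 N^(1 -
      1/q) = (h^2 N)^(1 - 1/q) = 1, so no constant survives.\<close>
    define t where "t = h m powr (1 - 1 / q)"
    have hc: "h m = t * c" using h by (simp add: c_def t_def flip: powr_add)
    have "t * t * N powr (1 - 1 / q) = (h m * h m * N) powr (1 - 1 / q)"
      using h by (simp add: t_def powr_mult)
    also have "\<dots> = 1" by (simp add: hN)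
    finally have tN: "t * t * N powr (1 - 1 / q) = 1" .
    have "h m * h m * ?S = (t * t) * (c * c * ?S)"
      unfolding hc by (simp only: mult_ac)
    also have "\<dots> \<le> (t * t) * (N powr (1 - 1 / q) * ?F * ?G)"
      by (intro mult_left_mono *) auto
    also have "\<dots> = (t * t * N powr (1 - 1 / q)) * (?F * ?G)" by (simp only: mult_ac)
    also have "\<dots> = ?F * ?G" by (simp only: tN mult_1)
    finally have "h m * h m * ?S \<le> ?F * ?G" .
    moreover have eq: "(\<Sum>k<N. h m *\<^sub>R (inner m (grid m k) * g (grid m k)))
      = (h m * h m) *\<^sub>R (\<Sum>j<N. \<Sum>k<N. f (grid m j) * g (grid m k) * cis (- 2 * pi * (grid m j * grid m k)))"
      by (subst sum.swap) (simp add: inner_def N_def scaleR_sum_right sum_distrib_left sum_distrib_right mult_ac)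
    moreover have "\<bar>h m * h m\<bar> = h m * h m" by simp
    ultimately show ?thesis unfolding N_def[symmetric] eq norm_scaleR by (simp only:)
  qed
  show ?thesis
  proof (rule tendsto_le[OF _ tendsto_mult[OF norms[OF f] norms[OF g]] tendsto_norm[OF lhs]])
    show "\<forall>\<^sub>F m in sequentially. cmod (\<Sum>k<4 * m\<^sup>2. h m *\<^sub>R (inner m (grid m k) * g (grid m k)))
     \<le> (\<Sum>j<4 * m\<^sup>2. h m *\<^sub>R (cmod (f (grid m j)) powr q)) powr (1 / q)
      * (\<Sum>j<4 * m\<^sup>2. h m *\<^sub>R (cmod (g (grid m j)) powr q)) powr (1 / q)"
      by (rule eventually_sequentiallyI[of 1]) (use ineq in simp)
  qed simp
qed

text \<open>The extremal test function \<open>g\<close>, the conjugate of \<open>fourier f\<close>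
  times its modulus to the power q' - 2, is inserted in the bilinear bound. Both the pairing and the
  q-th power integral of \<open>g\<close> equal \<open>B\<close>, so B \<le> ||f||_q B^(1/q), and
  cancelling leaves B^(1/q').\<close>

lemma hausdorff_young:
  assumes f: "decaying f" and F: "decaying (fourier f)" and q: "1 < q" "q \<le> 2"
  shows "Lnorm (q / (q - 1)) (fourier f) \<le> Lnorm q f"
proof -
  define q' where "q' = q / (q - 1)"
  have q': "q' \<ge> 2" "(q' - 1) * q = q'" "1 - 1 / q = 1 / q'" using q by (auto simp: q'_def field_simps)
  \<comment> \<open>the case distinction avoids \<open>0 powr 0 = 0\<close>, which would make \<open>w\<close> discontinuous\<close>
  define w where "w x = (if q' = 2 then 1 else cmod (fourier f x) powr (q' - 2))" for x
  define g where "g x = cnj (fourier f x) * of_real (w x)" for x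
  have w_cont: "continuous_on UNIV w"
    unfolding w_def by (cases "q' = 2")
      (use q' in \<open>auto intro!: continuous_on_norm_powr decaying_continuous F\<close>)
  have w: "w x \<ge> 0" "cmod (fourier f x) * w x = cmod (fourier f x) powr (q' - 1)" for x
  proof -
    show "w x \<ge> 0" by (simp add: w_def)
    show "cmod (fourier f x) * w x = cmod (fourier f x) powr (q' - 1)"
    proof (cases "fourier f x = 0")
      case False
      then have "cmod (fourier f x) * cmod (fourier f x) powr (q' - 2) = cmod (fourier f x) powr (1 + (q' - 2))"
        by (subst powr_add) simp
      then show ?thesis using False by (auto simp: w_def)
    qed simp
  qed
  obtain K where K: "K \<ge> 0" "\<And>x. cmod (fourier f x) \<le> K" using decayingE_bounded[OF F] by metis
  have g: "decaying g"
  proof (rule decaying_dominated[OF F, where K = "1 + K powr (q' - 2)"])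
    show "continuous_on UNIV g"
      unfolding g_def by (intro continuous_intros w_cont decaying_continuous F)
    have "w x \<le> 1 + K powr (q' - 2)" for x
      using powr_mono2[OF _ _ K(2)[of x], of "q' - 2"] q' by (auto simp: w_def)
    then show "cmod (g x) \<le> (1 + K powr (q' - 2)) * cmod (fourier f x)" for x
      using w(1)[of x] unfolding g_def norm_mult by (simp add: mult.commute[of "cmod (fourier f x)"] mult_right_mono)
  qed
  define B where "B = (\<integral>x. cmod (fourier f x) powr q' \<partial>lborel)"
  have B0: "B \<ge> 0" by (simp add: B_def)
  have "fourier f x * g x = of_real (cmod (fourier f x) powr q')" for x
  proof -
    have "fourier f x * g x = of_real (cmod (fourier f x) * (cmod (fourier f x) * w x))"
      unfolding g_def mult.assoc[symmetric] complex_norm_square[symmetric] by (simp add: power2_eq_square)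
    also have "cmod (fourier f x) * (cmod (fourier f x) * w x) = cmod (fourier f x) powr q'"
    proof (cases "fourier f x = 0")
      case False
      then have "cmod (fourier f x) * cmod (fourier f x) powr (q' - 1) = cmod (fourier f x) powr (1 + (q' - 1))"
        by (subst powr_add) simp
      then show ?thesis by (simp add: w)
    qed simp
    finally show ?thesis .
  qed
  then have "(\<integral>x. fourier f x * g x \<partial>lborel) = of_real B"
    by (simp add: B_def)
  moreover have "cmod (g x) powr q = cmod (fourier f x) powr q'" for x
  proof -
    have "cmod (g x) = cmod (fourier f x) powr (q' - 1)"
      using w(1)[of x] unfolding g_def norm_mult by (simp add: w)
    then show ?thesis by (simp add: powr_powr q')
  qed
  then have "Lnorm q g = B powr (1 / q)" by (simp add: Lnorm_def B_def)
  ultimately have le: "B \<le> Lnorm q f * B powr (1 / q)"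
    using fourier_bilinear_bound[OF f g q] B0 by simp
  have "B powr (1 / q') \<le> Lnorm q f"
  proof (cases "B = 0")
    case False
    then have "B powr (1 / q') * B powr (1 / q) = B"
      using B0 by (simp flip: powr_add q'(3))
    then have "B powr (1 / q') * B powr (1 / q) \<le> Lnorm q f * B powr (1 / q)" using le by simp
    then show ?thesis using False B0 by (simp add: mult_le_cancel_right)
  qed (simp add: Lnorm_def)
  then show ?thesis by (simp add: Lnorm_def B_def q'_def)
qed

section \<open>Schwartz functions and Gaussians\<close>

lemma iter_deriv_0 [simp]: "iter_deriv 0 f = f"
  by (simp add: iter_deriv_def)

lemma iter_deriv_Suc: "iter_deriv (Suc n) f = (\<lambda>x. vector_derivative (iter_deriv n f) (at x))"
  by (simp add: iter_deriv_def)

lemma schwartz_has_vector_derivative: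
  "f \<in> schwartz_space \<Longrightarrow> (iter_deriv n f has_vector_derivative iter_deriv (Suc n) f x) (at x)"
  by (simp add: schwartz_space_def iter_deriv_Suc vector_derivative_works)

lemma schwartz_iter_deriv_decaying:
  assumes "f \<in> schwartz_space"
  shows "decaying (iter_deriv n f)"
proof -
  have "bounded (range (\<lambda>x. x ^ m *\<^sub>R iter_deriv n f x))" for m
    using assms by (simp add: schwartz_space_def)
  from this[of 0] this[of 2] obtain A B where
    "\<And>x. cmod (iter_deriv n f x) \<le> A" "\<And>x. cmod (x\<^sup>2 *\<^sub>R iter_deriv n f x) \<le> B"
    by (auto simp: bounded_iff)
  then have "(1 + x\<^sup>2) * cmod (iter_deriv n f x) \<le> A + B" for x
    using add_mono[of "cmod (iter_deriv n f x)" A "cmod (x\<^sup>2 *\<^sub>R iter_deriv n f x)" B]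
    by (simp add: algebra_simps)
  then have "cmod (iter_deriv n f x) \<le> (A + B) / (1 + x\<^sup>2)" for x
    using one_plus_square_pos[of x] by (simp add: field_simps)
  moreover have "continuous_on UNIV (iter_deriv n f)"
    using assms by (auto simp: schwartz_space_def intro!: differentiable_imp_continuous_on differentiable_at_imp_differentiable_on)
  ultimately show ?thesis by (intro decayingI)
qed

lemma schwartz_decaying: "f \<in> schwartz_space \<Longrightarrow> decaying f"
  using schwartz_iter_deriv_decaying[of f 0] by simp

lemma iter_deriv_combination:
  assumes "f \<in> schwartz_space" "g \<in> schwartz_space"
  shows "iter_deriv n (\<lambda>x. a * f x + b * g x) = (\<lambda>x. a * iter_deriv n f x + b * iter_deriv n g x)"
proof (induction n)
  case (Suc n)
  show ?case unfolding iter_deriv_Suc[of n "\<lambda>x. a * f x + b * g x"] Suc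
    by (intro ext vector_derivative_at has_vector_derivative_add has_vector_derivative_mult_right
        schwartz_has_vector_derivative assms)
qed simp

lemma schwartz_combination:
  assumes f: "f \<in> schwartz_space" and g: "g \<in> schwartz_space"
  shows "(\<lambda>x. a * f x + b * g x) \<in> schwartz_space"
  unfolding schwartz_space_def mem_Collect_eq iter_deriv_combination[OF assms]
proof safe
  fix n m x
  show "(\<lambda>x. a * iter_deriv n f x + b * iter_deriv n g x) differentiable at x"
    using f g by (intro derivative_intros) (auto simp: schwartz_space_def)
  have "bounded (range (\<lambda>x. x ^ m *\<^sub>R iter_deriv n f x))" "bounded (range (\<lambda>x. x ^ m *\<^sub>R iter_deriv n g x))"
    using f g by (auto simp: schwartz_space_def)
  then obtain A B where A: "\<And>x. cmod (x ^ m *\<^sub>R iter_deriv n f x) \<le> A" and B: "\<And>x. cmod (x ^ m *\<^sub>R iter_deriv n g x) \<le> B"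
    by (auto simp: bounded_iff)
  have "cmod (x ^ m *\<^sub>R (a * iter_deriv n f x + b * iter_deriv n g x)) \<le> cmod a * A + cmod b * B" for x
  proof -
    have "x ^ m *\<^sub>R (a * iter_deriv n f x + b * iter_deriv n g x)
        = a * (x ^ m *\<^sub>R iter_deriv n f x) + b * (x ^ m *\<^sub>R iter_deriv n g x)"
      by (simp add: scaleR_add_right)
    also have "cmod \<dots> \<le> cmod a * cmod (x ^ m *\<^sub>R iter_deriv n f x) + cmod b * cmod (x ^ m *\<^sub>R iter_deriv n g x)"
      by (metis norm_mult norm_triangle_ineq)
    also have "\<dots> \<le> cmod a * A + cmod b * B" by (intro add_mono mult_left_mono A B) auto
    finally show ?thesis .
  qed
  then show "bounded (range (\<lambda>x. x ^ m *\<^sub>R (a * iter_deriv n f x + b * iter_deriv n g x)))"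
    by (auto simp: bounded_iff)
qed

section \<open>Integration by parts and the Fourier transform of derivatives\<close>

lemma decaying_tendsto_0:
  assumes "decaying f" "filterlim X at_infinity sequentially"
  shows "(\<lambda>n. f (X n)) \<longlonglongrightarrow> 0"
proof -
  obtain C where C: "\<And>x. cmod (f x) \<le> C / (1 + x\<^sup>2)" using decayingE[OF assms(1)] by metis
  have "filterlim (\<lambda>n. norm (X n)) at_top sequentially"
    using assms(2) by (rule filterlim_at_infinity_imp_norm_at_top)
  moreover have "((\<lambda>y::real. C / (1 + y\<^sup>2)) \<longlongrightarrow> 0) at_top" by real_asymp
  ultimately have "(\<lambda>n. C / (1 + (norm (X n))\<^sup>2)) \<longlonglongrightarrow> 0"
    by (rule filterlim_compose[rotated])
  then show ?thesis
    by (rule Lim_null_comparison[rotated]) (use C in auto)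
qed

text \<open>The fundamental theorem on [-n, n] leaves boundary terms that tend to 0. Applied to
  products this is integration by parts on the line.\<close>

lemma integral_derivative_decaying:
  assumes G: "decaying G" and g: "decaying g"
    and d: "\<And>x. (G has_vector_derivative g x) (at x)"
  shows "(\<integral>x. g x \<partial>lborel) = 0"
proof -
  have "(\<lambda>n. \<integral>x. indicator {- real n..real n} x *\<^sub>R g x \<partial>lborel) \<longlonglongrightarrow> (\<integral>x. g x \<partial>lborel)"
  proof (rule integral_dominated_convergence[where w = "\<lambda>x. norm (g x)"])
    have "(\<lambda>n. indicator {- real n..real n} x *\<^sub>R g x) \<longlonglongrightarrow> g x" for x
    proof (rule tendsto_eventually)
      obtain M :: nat where M: "\<bar>x\<bar> < real M" using reals_Archimedean2 by blast
      show "\<forall>\<^sub>F n in sequentially. indicator {- real n..real n} x *\<^sub>R g x = g x"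
        by (rule eventually_sequentiallyI[of M]) (use M in \<open>auto simp: indicator_def\<close>)
    qed
    then show "AE x in lborel. (\<lambda>n. indicator {- real n..real n} x *\<^sub>R g x) \<longlonglongrightarrow> g x" by simp
    show "g \<in> borel_measurable lborel" using decaying_borel[OF g] by simp
    then show "(\<lambda>x. indicator {- real n..real n} x *\<^sub>R g x) \<in> borel_measurable lborel" for n by measurable
  qed (use decaying_integrable[OF g] in \<open>auto simp: indicator_def\<close>)
  moreover have "(\<integral>x. indicator {- real n..real n} x *\<^sub>R g x \<partial>lborel) = G (real n) - G (- real n)" for n
  proof (rule integral_FTC_atLeastAtMost)
    show "continuous_on {- real n..real n} g"
      using decaying_continuous[OF g] continuous_on_subset by blast
  qed (auto intro: has_vector_derivative_at_within d)
  moreover have "(\<lambda>n. G (real n) - G (- real n)) \<longlonglongrightarrow> 0 - 0"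
    by (intro tendsto_diff decaying_tendsto_0[OF G]) 
       (simp_all add: filterlim_at_infinity_conv_norm_at_top filterlim_real_sequentially)
  ultimately show ?thesis by (simp add: LIMSEQ_unique)
qed

lemma cis_has_vector_derivative:
  "((\<lambda>x. cis (a * x)) has_vector_derivative \<i> * of_real a * cis (a * x)) (at x)"
proof -
  have "((\<lambda>x. cis (a * x)) has_derivative (\<lambda>t. (a * t) *\<^sub>R (\<i> * cis (a * x)))) (at x)"
    by (intro derivative_intros)
  then show ?thesis by (simp add: has_vector_derivative_def scaleR_conv_of_real mult_ac)
qed

lemma decaying_mult_cis: "decaying f \<Longrightarrow> decaying (\<lambda>x. f x * cis (a * x))"
proof (rule decaying_dominated[of f _ 1])
  assume "decaying f"
  then show "continuous_on UNIV (\<lambda>x. f x * cis (a * x))"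
    by (intro continuous_intros decaying_continuous)
qed (auto simp: norm_mult)

text \<open>The derivative of \<open>f x * cis (a * x)\<close> has integral 0; the product rule
  splits this integral into the two transforms.\<close>

lemma fourier_deriv:
  assumes f: "decaying f" and f': "decaying f'" and d: "\<And>x. (f has_vector_derivative f' x) (at x)"
  shows "fourier f' \<xi> = 2 * pi * \<i> * \<xi> * fourier f \<xi>"
proof -
  define a where "a = - 2 * pi * \<xi>"
  have cis: "cis (- 2 * pi * (x * \<xi>)) = cis (a * x)" for x by (simp add: a_def mult_ac)
  have "(\<integral>x. f' x * cis (a * x) + f x * (\<i> * of_real a * cis (a * x)) \<partial>lborel) = 0"
  proof (rule integral_derivative_decaying)
    show "decaying (\<lambda>x. f x * cis (a * x))" using f by (rule decaying_mult_cis)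
    have "decaying (\<lambda>x. f' x * cis (a * x) + (\<i> * of_real a) * (f x * cis (a * x)))"
      by (intro decaying_add decaying_cmult decaying_mult_cis f f')
    then show "decaying (\<lambda>x. f' x * cis (a * x) + f x * (\<i> * of_real a * cis (a * x)))"
      by (simp add: mult_ac)
    show "((\<lambda>x. f x * cis (a * x)) has_vector_derivative f' x * cis (a * x) + f x * (\<i> * of_real a * cis (a * x))) (at x)" for x
      using has_vector_derivative_mult[OF d[of x] cis_has_vector_derivative[of a x]] by (simp add: add.commute)
  qed
  also have "(\<lambda>x. f' x * cis (a * x) + f x * (\<i> * of_real a * cis (a * x)))
      = (\<lambda>x. f' x * cis (a * x) + (\<i> * of_real a) * (f x * cis (a * x)))" by (simp add: mult_ac)
  finally have "(\<integral>x. f' x * cis (a * x) \<partial>lborel) + (\<i> * of_real a) * (\<integral>x. f x * cis (a * x) \<partial>lborel) = 0"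
    by (subst (asm) Bochner_Integration.integral_add)
       (use decaying_integrable[OF decaying_mult_cis] f f' in auto)
  then have "fourier f' \<xi> + (\<i> * of_real a) * fourier f \<xi> = 0"
    unfolding fourier_cis cis .
  then have "fourier f' \<xi> = - (\<i> * of_real a) * fourier f \<xi>" by (simp add: eq_neg_iff_add_eq_0)
  then show ?thesis by (simp add: a_def mult_ac)
qed

lemma fourier_norm_le: "cmod (fourier f \<xi>) \<le> (\<integral>x. cmod (f x) \<partial>lborel)"
  unfolding fourier_cis by (rule order_trans[OF integral_norm_bound]) (simp add: norm_mult)

text \<open>Two integrations by parts bound (2 pi \<xi>)^2 times the transform by the L^1 norm
  \<open>B\<close> of the second derivative, and \<open>A\<close> bounds the transform itself. As 2
  pi \<ge> 1, adding the two bounds gives quadratic decay.\<close>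

lemma fourier_schwartz_decaying:
  assumes f: "f \<in> schwartz_space"
  shows "decaying (fourier f)"
proof -
  define A where "A = (\<integral>x. cmod (f x) \<partial>lborel)"
  define B where "B = (\<integral>x. cmod (iter_deriv 2 f x) \<partial>lborel)"
  have deriv: "fourier (iter_deriv (Suc n) f) \<xi> = 2 * pi * \<i> * \<xi> * fourier (iter_deriv n f) \<xi>" for n \<xi>
    by (intro fourier_deriv schwartz_iter_deriv_decaying schwartz_has_vector_derivative f)
  have "cmod (fourier f \<xi>) \<le> (A + B) / (1 + \<xi>\<^sup>2)" for \<xi>
  proof -
    have "(2 * pi)\<^sup>2 * \<xi>\<^sup>2 * cmod (fourier f \<xi>) = cmod (fourier (iter_deriv 2 f) \<xi>)"
      using deriv[of 1 \<xi>] deriv[of 0 \<xi>]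
      by (simp add: numeral_2_eq_2 norm_mult power2_eq_square)
    also have "\<dots> \<le> B" unfolding B_def by (rule fourier_norm_le)
    finally have B: "(2 * pi)\<^sup>2 * \<xi>\<^sup>2 * cmod (fourier f \<xi>) \<le> B" .
    have "1 \<le> 2 * pi" using pi_gt3 by simp
    then have "1\<^sup>2 \<le> (2 * pi)\<^sup>2" by (intro power_mono) auto
    then have "1 * (\<xi>\<^sup>2 * cmod (fourier f \<xi>)) \<le> (2 * pi)\<^sup>2 * (\<xi>\<^sup>2 * cmod (fourier f \<xi>))"
      by (intro mult_right_mono) auto
    then have "\<xi>\<^sup>2 * cmod (fourier f \<xi>) \<le> B" using B by (simp add: mult.assoc)
    moreover have "cmod (fourier f \<xi>) \<le> A" unfolding A_def by (rule fourier_norm_le)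
    ultimately have "(1 + \<xi>\<^sup>2) * cmod (fourier f \<xi>) \<le> A + B" by (simp add: algebra_simps)
    then show ?thesis using one_plus_square_pos[of \<xi>] by (simp add: field_simps)
  qed
  then show ?thesis by (rule decayingI[OF fourier_continuous[OF schwartz_decaying[OF f]]])
qed

lemma fourier_combination:
  assumes f: "decaying f" and g: "decaying g"
  shows "fourier (\<lambda>x. a * f x + b * g x) = (\<lambda>\<xi>. a * fourier f \<xi> + b * fourier g \<xi>)"
proof
  fix \<xi>
  have "fourier (\<lambda>x. a * f x + b * g x) \<xi> = (\<integral>x. a * (f x * cis (- 2 * pi * (x * \<xi>))) + b * (g x * cis (- 2 * pi * (x * \<xi>))) \<partial>lborel)"
    unfolding fourier_cis by (simp add: algebra_simps)
  also have "\<dots> = a * fourier f \<xi> + b * fourier g \<xi>"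
    unfolding fourier_cis using fourier_integrable[OF f, of \<xi>] fourier_integrable[OF g, of \<xi>] by simp
  finally show "fourier (\<lambda>x. a * f x + b * g x) \<xi> = a * fourier f \<xi> + b * fourier g \<xi>" .
qed

text \<open>Differentiation under the integral with an explicit error: |exp(it) - 1 - it| \<le>
  t^2/2 at t = -2 pi x h bounds the remainder by \<open>K * h^2\<close>, where the second moment in
  \<open>K\<close> is finite by the third hypothesis.\<close>

lemma fourier_has_vector_derivative:
  assumes f: "decaying f" and f1: "decaying (\<lambda>x. of_real x * f x)" and f2: "decaying (\<lambda>x. of_real (x\<^sup>2) * f x)"
  shows "(fourier f has_vector_derivative - 2 * pi * \<i> * fourier (\<lambda>x. of_real x * f x) \<xi>) (at \<xi>)"
proof -
  let ?D = "- 2 * pi * \<i> * fourier (\<lambda>x. of_real x * f x) \<xi>"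
  define K where "K = (2 * pi\<^sup>2) * (\<integral>x. cmod (of_real (x\<^sup>2) * f x) \<partial>lborel)"
  have quad: "cmod (fourier f (\<xi> + h) - fourier f \<xi> - h *\<^sub>R ?D) \<le> K * h\<^sup>2" for h
  proof -
    let ?e = "\<lambda>x \<eta>. cis (- 2 * pi * (x * \<eta>))"
    define r where "r x = f x * ?e x (\<xi> + h) - f x * ?e x \<xi> - (- 2 * pi * \<i> * h) * ((of_real x * f x) * ?e x \<xi>)" for x
    have "fourier f (\<xi> + h) - fourier f \<xi> - h *\<^sub>R ?D = (\<integral>x. r x \<partial>lborel)"
      unfolding r_def fourier_cis using fourier_integrable[OF f] fourier_integrable[OF f1]
      by (simp add: scaleR_conv_of_real)
    also have "cmod \<dots> \<le> (\<integral>x. cmod (r x) \<partial>lborel)" by (rule integral_norm_bound)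
    also have "\<dots> \<le> (\<integral>x. (2 * pi\<^sup>2 * h\<^sup>2) * cmod (of_real (x\<^sup>2) * f x) \<partial>lborel)"
    proof (rule integral_mono)
      show "integrable lborel (\<lambda>x. cmod (r x))"
        unfolding r_def using fourier_integrable[OF f] fourier_integrable[OF f1]
        by (intro integrable_norm Bochner_Integration.integrable_diff integrable_mult_right)
      show "integrable lborel (\<lambda>x. (2 * pi\<^sup>2 * h\<^sup>2) * cmod (of_real (x\<^sup>2) * f x))"
        using decaying_integrable[OF f2] by (intro integrable_mult_right integrable_norm)
      show "cmod (r x) \<le> (2 * pi\<^sup>2 * h\<^sup>2) * cmod (of_real (x\<^sup>2) * f x)" for x
      proof -
        define t where "t = - 2 * pi * (x * h)"
        have "?e x (\<xi> + h) = ?e x \<xi> * cis t" by (simp add: t_def cis_mult algebra_simps)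
        then have "r x = f x * ?e x \<xi> * (cis t - 1 - \<i> * t)"
          by (simp add: r_def t_def algebra_simps)
        then have "cmod (r x) = cmod (f x) * cmod (cis t - (1 + \<i> * t))"
          by (simp add: norm_mult diff_diff_eq)
        also have "\<dots> \<le> cmod (f x) * (t\<^sup>2 / 2)"
          by (intro mult_left_mono)
             (use iexp_approx1[of t 1] in \<open>simp_all add: cis_conv_exp eval_nat_numeral\<close>)
        also have "t\<^sup>2 / 2 = 2 * pi\<^sup>2 * h\<^sup>2 * x\<^sup>2" by (simp add: t_def power2_eq_square)
        finally show ?thesis by (simp add: norm_mult norm_power mult_ac)
      qed
    qed
    also have "\<dots> = K * h\<^sup>2" by (simp add: K_def)
    finally show ?thesis .
  qed
  show ?thesis unfolding has_vector_derivative_def has_derivative_at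
  proof
    show "bounded_linear (\<lambda>x. x *\<^sub>R ?D)" by (rule bounded_linear_scaleR_left)
    show "(\<lambda>h. cmod (fourier f (\<xi> + h) - fourier f \<xi> - h *\<^sub>R ?D) / norm h) \<midarrow>0\<rightarrow> 0"
    proof (rule Lim_null_comparison)
      show "\<forall>\<^sub>F h in at 0. norm (cmod (fourier f (\<xi> + h) - fourier f \<xi> - h *\<^sub>R ?D) / norm h) \<le> K * \<bar>h\<bar>"
      proof (intro always_eventually allI)
        fix h
        show "norm (cmod (fourier f (\<xi> + h) - fourier f \<xi> - h *\<^sub>R ?D) / norm h) \<le> K * \<bar>h\<bar>"
        proof (cases "h = 0")
          case False
          have "cmod (fourier f (\<xi> + h) - fourier f \<xi> - h *\<^sub>R ?D) / \<bar>h\<bar> \<le> (K * h\<^sup>2) / \<bar>h\<bar>"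
            by (intro divide_right_mono quad) auto
          also have "\<dots> = K * \<bar>h\<bar>" using False by (simp add: field_simps power2_eq_square)
          finally show ?thesis by simp
        qed simp
      qed
      show "(\<lambda>h. K * \<bar>h\<bar>) \<midarrow>0\<rightarrow> 0"
        by (rule tendsto_eq_intros refl)+ simp
    qed
  qed
qed

section \<open>Gaussians with complex parameter, including chirps\<close>

definition gaussian :: "complex \<Rightarrow> real \<Rightarrow> complex" where
  "gaussian a x = exp (- of_real pi * a * (of_real x)\<^sup>2)"

lemma norm_gaussian: "cmod (gaussian a x) = exp (- pi * Re a * x\<^sup>2)"
  by (simp add: gaussian_def power2_eq_square)

lemma gaussian_of_real: "gaussian (of_real s) x = of_real (exp (- pi * s * x\<^sup>2))"
  by (simp add: gaussian_def exp_of_real[symmetric])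

lemma gaussian_nonzero: "gaussian a x \<noteq> 0"
  by (simp add: gaussian_def)

text \<open>Polynomial multiples of a Gaussian are closed under differentiation
  (\<open>pCons 0 P\<close> is X P), so every iterated derivative is of this form.\<close>

lemma poly_gaussian_has_vector_derivative:
  "((\<lambda>x. poly P (of_real x) * gaussian a x) has_vector_derivative
     poly (pderiv P - smult (2 * of_real pi * a) (pCons 0 P)) (of_real x) * gaussian a x) (at x)"
proof -
  have "((\<lambda>z. poly P z * exp (- of_real pi * a * z\<^sup>2)) has_field_derivative
     poly (pderiv P - smult (2 * of_real pi * a) (pCons 0 P)) z * exp (- of_real pi * a * z\<^sup>2)) (at z)" for z
    by (rule derivative_eq_intros poly_DERIV refl)+ (simp add: algebra_simps)
  from has_vector_derivative_real_field[OF this] show ?thesis unfolding gaussian_def .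
qed

lemma iter_deriv_gaussian: "\<exists>P. iter_deriv n (gaussian a) = (\<lambda>x. poly P (of_real x) * gaussian a x)"
proof (induction n)
  case 0
  show ?case by (rule exI[of _ 1]) simp
next
  case (Suc n)
  then obtain P where "iter_deriv n (gaussian a) = (\<lambda>x. poly P (of_real x) * gaussian a x)" by blast
  then show ?case
    unfolding iter_deriv_Suc using vector_derivative_at[OF poly_gaussian_has_vector_derivative[of P a]] by metis
qed

text \<open>A single term of the exponential series gives (c x^2)^m / m! \<le> exp(c x^2), and |x|^m
  \<le> 1 + x^(2m) reduces to that even power.\<close>

lemma power_gaussian_bounded:
  assumes "Re a > 0"
  shows "\<exists>C. \<forall>x. \<bar>x\<bar> ^ m * cmod (gaussian a x) \<le> C"
proof -
  define c where "c = pi * Re a"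
  have c: "c > 0" using assms by (simp add: c_def)
  have "\<bar>x\<bar> ^ m * exp (- c * x\<^sup>2) \<le> 1 + fact m / c ^ m" for x
  proof -
    have "(c * x\<^sup>2) ^ m / fact m \<le> exp (c * x\<^sup>2)"
      using sum_le_suminf[OF summable_exp_generic, of "{m}" "c * x\<^sup>2"] c
      by (simp add: exp_def divide_inverse mult.commute)
    then have "(x\<^sup>2) ^ m \<le> fact m / c ^ m * exp (c * x\<^sup>2)"
      using c by (simp add: field_simps power_mult_distrib)
    moreover have "1 \<le> exp (c * x\<^sup>2)" using c by simp
    moreover have "\<bar>x\<bar> ^ m \<le> 1 + (x\<^sup>2) ^ m"
    proof (cases "\<bar>x\<bar> \<le> 1")
      case True
      then have "\<bar>x\<bar> ^ m \<le> 1" by (simp add: power_le_one)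
      then show ?thesis by (simp add: add_increasing2)
    next
      case False
      then have "\<bar>x\<bar> ^ m \<le> \<bar>x\<bar> ^ (2 * m)" by (intro power_increasing) auto
      then show ?thesis by (simp add: power_mult)
    qed
    ultimately have "\<bar>x\<bar> ^ m \<le> (1 + fact m / c ^ m) * exp (c * x\<^sup>2)"
      unfolding distrib_right by linarith
    then show ?thesis by (simp add: exp_minus field_simps)
  qed
  then show ?thesis unfolding norm_gaussian c_def by auto
qed

text \<open>Induction on the polynomial for all \<open>m\<close> at once: in b + X P the factor X is
  absorbed into the weight, raising \<open>m\<close> by one.\<close>

lemma poly_gaussian_bounded:
  assumes "Re a > 0"
  shows "bounded (range (\<lambda>x. x ^ m *\<^sub>R (poly P (of_real x) * gaussian a x)))"
proof (induction P arbitrary: m)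
  case (pCons b P)
  obtain C where C: "\<And>x. \<bar>x\<bar> ^ m * cmod (gaussian a x) \<le> C" using power_gaussian_bounded[OF assms] by blast
  obtain D where D: "\<And>x. cmod (x ^ Suc m *\<^sub>R (poly P (of_real x) * gaussian a x)) \<le> D"
    using pCons.IH[of "Suc m"] by (auto simp: bounded_iff)
  have "cmod (x ^ m *\<^sub>R (poly (pCons b P) (of_real x) * gaussian a x)) \<le> cmod b * C + D" for x
  proof -
    have "x ^ m *\<^sub>R (poly (pCons b P) (of_real x) * gaussian a x)
       = b * (x ^ m *\<^sub>R gaussian a x) + x ^ Suc m *\<^sub>R (poly P (of_real x) * gaussian a x)"
      by (simp add: scaleR_conv_of_real algebra_simps)
    also have "cmod \<dots> \<le> cmod b * (\<bar>x\<bar> ^ m * cmod (gaussian a x)) + D"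
      by (rule order_trans[OF norm_triangle_ineq add_mono[OF _ D]]) (simp add: norm_mult power_abs)
    also have "\<dots> \<le> cmod b * C + D" by (intro add_mono mult_left_mono C) auto
    finally show ?thesis .
  qed
  then show ?case by (auto simp: bounded_iff)
qed simp

lemma gaussian_schwartz:
  assumes "Re a > 0"
  shows "gaussian a \<in> schwartz_space"
  unfolding schwartz_space_def mem_Collect_eq
proof (intro conjI allI)
  fix n m :: nat and x :: real
  obtain P where P: "iter_deriv n (gaussian a) = (\<lambda>x. poly P (of_real x) * gaussian a x)"
    using iter_deriv_gaussian by blast
  show "iter_deriv n (gaussian a) differentiable at x"
    unfolding P using differentiableI_vector[OF poly_gaussian_has_vector_derivative] .
  show "bounded (range (\<lambda>x. x ^ m *\<^sub>R iter_deriv n (gaussian a) x))"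
    unfolding P by (rule poly_gaussian_bounded[OF assms])
qed

lemma poly_gaussian_decaying:
  assumes "Re a > 0"
  shows "decaying (\<lambda>x. poly P (of_real x) * gaussian a x)" (is "decaying ?f")
proof -
  obtain A B where
    "\<And>x. cmod (?f x) \<le> A" "\<And>x. cmod (x\<^sup>2 *\<^sub>R ?f x) \<le> B"
    using poly_gaussian_bounded[OF assms, of 0 P] poly_gaussian_bounded[OF assms, of 2 P]
    by (auto simp: bounded_iff)
  then have "(1 + x\<^sup>2) * cmod (?f x) \<le> A + B" for x
    using add_mono[of "cmod (?f x)" A "cmod (x\<^sup>2 *\<^sub>R ?f x)" B]
    by (simp add: algebra_simps)
  then have "cmod (?f x) \<le> (A + B) / (1 + x\<^sup>2)" for x
    using one_plus_square_pos[of x] by (simp add: field_simps)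
  moreover have "continuous_on UNIV ?f"
    unfolding gaussian_def by (intro continuous_intros)
  ultimately show ?thesis by (intro decayingI)
qed

text \<open>Differentiation of the Gaussian yields multiplication by x, so the two derivative rules
  give a first-order linear equation for the transform. The value at 0 is left unevaluated: it
  cancels in the norm quotient, which avoids choosing a complex square root.\<close>

lemma fourier_gaussian:
  assumes a: "Re a > 0"
  shows "fourier (gaussian a) \<xi> = fourier (gaussian a) 0 * gaussian (1 / a) \<xi>"
proof -
  have a0: "a \<noteq> 0" using a by auto
  have g: "decaying (gaussian a)" using poly_gaussian_decaying[OF a, of 1] by simp
  have g1: "decaying (\<lambda>x. of_real x * gaussian a x)" using poly_gaussian_decaying[OF a, of "[:0, 1:]"] by simp
  have g2: "decaying (\<lambda>x. of_real (x\<^sup>2) * gaussian a x)"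
    using poly_gaussian_decaying[OF a, of "[:0, 0, 1:]"] by (simp add: power2_eq_square)
  have "fourier (\<lambda>x. - 2 * of_real pi * a * (of_real x * gaussian a x)) \<xi> = 2 * pi * \<i> * \<xi> * fourier (gaussian a) \<xi>" for \<xi>
  proof (rule fourier_deriv)
    show "decaying (\<lambda>x. - 2 * of_real pi * a * (of_real x * gaussian a x))" by (rule decaying_cmult[OF g1])
    show "(gaussian a has_vector_derivative - 2 * of_real pi * a * (of_real x * gaussian a x)) (at x)" for x
      using poly_gaussian_has_vector_derivative[of 1 a x] by (simp add: mult_ac)
  qed (rule g)
  moreover have "fourier (\<lambda>x. - 2 * of_real pi * a * (of_real x * gaussian a x)) \<xi>
      = - 2 * of_real pi * a * fourier (\<lambda>x. of_real x * gaussian a x) \<xi>" for \<xi>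
    using fun_cong[OF fourier_combination[OF g1 g1, of "- 2 * of_real pi * a" 0]] by simp
  ultimately have eq: "- 2 * of_real pi * a * fourier (\<lambda>x. of_real x * gaussian a x) \<xi> = 2 * pi * \<i> * \<xi> * fourier (gaussian a) \<xi>" for \<xi>
    by metis
  have x_mult: "fourier (\<lambda>x. of_real x * gaussian a x) \<xi> = - \<i> * \<xi> / a * fourier (gaussian a) \<xi>" for \<xi>
  proof -
    have "- 2 * of_real pi * a * (- \<i> * \<xi> / a * fourier (gaussian a) \<xi>) = 2 * pi * \<i> * \<xi> * fourier (gaussian a) \<xi>"
      using a0 by simp
    then have "- 2 * of_real pi * a * fourier (\<lambda>x. of_real x * gaussian a x) \<xi>
        = - 2 * of_real pi * a * (- \<i> * \<xi> / a * fourier (gaussian a) \<xi>)"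
      using eq by metis
    moreover have "- 2 * of_real pi * a \<noteq> 0" using a0 by simp
    ultimately show ?thesis using mult_left_cancel by blast
  qed
  \<comment> \<open>the transform satisfies the linear equation \<open>y' = - (2 \<pi> \<xi> / a) y\<close>\<close>
  define H where "H \<xi> = fourier (gaussian a) \<xi> * gaussian (- 1 / a) \<xi>" for \<xi>
  have "(H has_vector_derivative 0) (at \<xi>)" for \<xi>
  proof -
    have d1: "(fourier (gaussian a) has_vector_derivative - 2 * pi * \<i> * (- \<i> * \<xi> / a * fourier (gaussian a) \<xi>)) (at \<xi>)"
      using fourier_has_vector_derivative[OF g g1 g2, of \<xi>] unfolding x_mult .
    have d2: "(gaussian (- 1 / a) has_vector_derivative (2 * of_real pi / a) * of_real \<xi> * gaussian (- 1 / a) \<xi>) (at \<xi>)"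
      using poly_gaussian_has_vector_derivative[of 1 "- 1 / a" \<xi>] by (simp add: mult_ac)
    show ?thesis unfolding H_def
      using has_vector_derivative_mult[OF d1 d2] by (simp add: field_simps)
  qed
  then obtain c where c: "\<And>\<xi>. H \<xi> = c"
    using has_vector_derivative_zero_constant[of UNIV H] by auto
  have "gaussian (- 1 / a) \<xi> * gaussian (1 / a) \<xi> = 1" for \<xi>
    by (simp add: gaussian_def flip: exp_add)
  then have "fourier (gaussian a) \<xi> = c * gaussian (1 / a) \<xi>" for \<xi>
    using c[of \<xi>] unfolding H_def by (metis mult.assoc mult.right_neutral)
  moreover from this[of 0] have "fourier (gaussian a) 0 = c" by (simp add: gaussian_def)
  ultimately show ?thesis by simp
qed

text \<open>Up to the factor \<open>sqrt s\<close> the integrand is the normal density of variance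
  1/(2 pi s), whose total mass is 1.\<close>

lemma integral_gaussian:
  assumes "s > 0"
  shows "(\<integral>x. exp (- pi * s * x\<^sup>2) \<partial>lborel) = 1 / sqrt s"
proof -
  define \<sigma> where "\<sigma> = 1 / sqrt (2 * pi * s)"
  have \<sigma>: "\<sigma>\<^sup>2 = 1 / (2 * pi * s)" using assms by (simp add: \<sigma>_def power_divide)
  have eq: "exp (- pi * s * x\<^sup>2) = normal_density 0 \<sigma> x / sqrt s" for x
    using assms unfolding normal_density_def \<sigma> by (simp add: real_sqrt_divide)
  have "\<sigma> > 0" using assms by (simp add: \<sigma>_def)
  show ?thesis unfolding eq by (simp add: \<open>\<sigma> > 0\<close>)
qed

lemma fourier_real_gaussian:
  assumes s: "s > 0"
  shows "fourier (gaussian (of_real s)) \<xi> = of_real (1 / sqrt s) * gaussian (of_real (1 / s)) \<xi>"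
proof -
  have "fourier (gaussian (of_real s)) 0 = (\<integral>x. of_real (exp (- pi * s * x\<^sup>2)) \<partial>lborel)"
    by (simp add: fourier_cis gaussian_of_real)
  also have "\<dots> = of_real (1 / sqrt s)"
    by (simp only: integral_complex_of_real integral_gaussian[OF s])
  finally show ?thesis using fourier_gaussian[of "of_real s" \<xi>] s by simp
qed

section \<open>Fourier inversion and the lower bound\<close>

lemma gaussian_decaying: "Re a > 0 \<Longrightarrow> decaying (gaussian a)"
  by (rule schwartz_decaying[OF gaussian_schwartz])

text \<open>Gauss summation: the outer integral is damped by Gaussians \<open>K n\<close> tending to
  1. After Fubini the damped integral averages \<open>f\<close> near \<open>- x\<close> against ever
  narrower Gaussians of mass 1. Both descriptions of \<open>I n\<close> converge, and their limits
  agree.\<close>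

lemma fourier_inversion:
  assumes f: "decaying f" and F: "decaying (fourier f)"
  shows "fourier (fourier f) x = f (- x)"
proof -
  define N where "N n = real (Suc n)" for n
  define s where "s n = 1 / (N n)\<^sup>2" for n
  define K where "K n = gaussian (of_real (s n))" for n
  have N: "N n > 0" for n by (simp add: N_def)
  have s: "s n > 0" "sqrt (s n) = 1 / N n" "1 / s n = (N n)\<^sup>2" for n
    using N[of n] by (auto simp: s_def real_sqrt_divide)
  have K: "decaying (K n)" for n
    unfolding K_def using s by (intro gaussian_decaying) simp
  have K1: "cmod (K n \<xi>) \<le> 1" for n \<xi>
    using s(1)[of n] by (simp add: K_def norm_gaussian)
  have N_lim: "(\<lambda>n. 1 / N n) \<longlonglongrightarrow> 0" unfolding N_def by real_asymp
  have s_lim: "s \<longlonglongrightarrow> 0" unfolding s_def N_def by real_asymp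
  define I where "I n = (\<integral>\<xi>. fourier f \<xi> * cis (- 2 * pi * (\<xi> * x)) * K n \<xi> \<partial>lborel)" for n
  have "I \<longlonglongrightarrow> fourier (fourier f) x"
    unfolding I_def fourier_cis[of "fourier f"]
  proof (rule integral_dominated_convergence[where w = "\<lambda>\<xi>. cmod (fourier f \<xi>)"])
    have meas: "(\<lambda>\<xi>. fourier f \<xi> * cis (- 2 * pi * (\<xi> * x))) \<in> borel_measurable borel"
      using borel_measurable_integrable[OF fourier_integrable[OF F, of x]] by simp
    then show "(\<lambda>\<xi>. fourier f \<xi> * cis (- 2 * pi * (\<xi> * x))) \<in> borel_measurable lborel" by simp
    show "(\<lambda>\<xi>. fourier f \<xi> * cis (- 2 * pi * (\<xi> * x)) * K n \<xi>) \<in> borel_measurable lborel" for n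
      using borel_measurable_times[OF meas decaying_borel[OF K]] by simp
    have "(\<lambda>n. K n \<xi>) \<longlonglongrightarrow> 1" for \<xi>
    proof -
      have "(\<lambda>n. exp (- pi * s n * \<xi>\<^sup>2)) \<longlonglongrightarrow> exp (- pi * 0 * \<xi>\<^sup>2)"
        by (intro tendsto_intros s_lim)
      then have "(\<lambda>n. complex_of_real (exp (- pi * s n * \<xi>\<^sup>2))) \<longlonglongrightarrow> of_real (exp (- pi * 0 * \<xi>\<^sup>2))"
        by (rule tendsto_of_real)
      then show ?thesis by (simp add: K_def gaussian_of_real)
    qed
    from tendsto_mult[OF tendsto_const this]
    show "AE \<xi> in lborel. (\<lambda>n. fourier f \<xi> * cis (- 2 * pi * (\<xi> * x)) * K n \<xi>) \<longlonglongrightarrow> fourier f \<xi> * cis (- 2 * pi * (\<xi> * x))"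
      by (intro AE_I2) (metis mult.right_neutral)
    show "AE \<xi> in lborel. cmod (fourier f \<xi> * cis (- 2 * pi * (\<xi> * x)) * K n \<xi>) \<le> cmod (fourier f \<xi>)" for n
      using K1 by (intro AE_I2) (simp add: norm_mult mult_left_le)
  qed (use decaying_integrable[OF F] in simp)
  \<comment> \<open>Fubini moves the transform onto \<open>K n\<close>, producing the Gaussian N
    exp(-pi N^2 (y + x)^2); the substitution y = -x + t/N then removes \<open>N\<close> from the
    kernel.\<close>
  moreover have I_eq: "I n = (\<integral>t. f (- x + 1 / N n * t) * gaussian 1 t \<partial>lborel)" for n
  proof -
    define h where "h y \<xi> = f y * cis (- 2 * pi * (y * \<xi>)) * (cis (- 2 * pi * (\<xi> * x)) * K n \<xi>)" for y \<xi>
    have [measurable]: "f \<in> borel_measurable borel" "K n \<in> borel_measurable borel" "cis \<in> borel_measurable borel"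
      using decaying_borel[OF f] decaying_borel[OF K] borel_measurable_continuous_onI[of cis]
        continuous_on_cis[OF continuous_on_id] by auto
    have h_int: "integrable (lborel \<Otimes>\<^sub>M lborel) (case_prod h)"
    proof (rule lborel_pair.Fubini_integrable)
      show "case_prod h \<in> borel_measurable (lborel \<Otimes>\<^sub>M lborel)"
        unfolding h_def by measurable
      show "integrable lborel (\<lambda>y. \<integral>\<xi>. norm (case_prod h (y, \<xi>)) \<partial>lborel)"
        using decaying_integrable[OF f] by (simp add: h_def norm_mult)
      have "integrable lborel (h y)" for y
      proof (rule Bochner_Integration.integrable_bound)
        show "integrable lborel (\<lambda>\<xi>. f y * K n \<xi>)"
          using decaying_integrable[OF K[of n]] by (intro integrable_mult_right)
        show "h y \<in> borel_measurable lborel" unfolding h_def by measurable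
      qed (simp add: h_def norm_mult)
      then show "AE y in lborel. integrable lborel (\<lambda>\<xi>. case_prod h (y, \<xi>))" by simp
    qed
    have "I n = (\<integral>\<xi>. (\<integral>y. h y \<xi> \<partial>lborel) \<partial>lborel)"
      unfolding I_def h_def fourier_cis[of f] integral_mult_left_zero by (simp only: mult.assoc)
    also have "\<dots> = (\<integral>y. (\<integral>\<xi>. h y \<xi> \<partial>lborel) \<partial>lborel)"
      by (rule lborel_pair.Fubini_integral[OF h_int])
    also have "\<dots> = (\<integral>y. f y * fourier (K n) (y + x) \<partial>lborel)"
    proof (intro Bochner_Integration.integral_cong refl)
      fix y
      have "h y \<xi> = f y * (K n \<xi> * cis (- 2 * pi * (\<xi> * (y + x))))" for \<xi>
      proof -
        have "cis (- 2 * pi * (\<xi> * (y + x))) = cis (- 2 * pi * (y * \<xi>)) * cis (- 2 * pi * (\<xi> * x))"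
          by (simp add: cis_mult algebra_simps)
        then show ?thesis unfolding h_def by (simp only: mult_ac)
      qed
      then show "(\<integral>\<xi>. h y \<xi> \<partial>lborel) = f y * fourier (K n) (y + x)"
        unfolding fourier_cis by simp
    qed
    also have "\<dots> = (\<integral>y. f y * (of_real (N n) * gaussian (of_real ((N n)\<^sup>2)) (y + x)) \<partial>lborel)"
      unfolding K_def fourier_real_gaussian[OF s(1)] s(2,3) by simp
    also have "\<dots> = \<bar>1 / N n\<bar> *\<^sub>R (\<integral>t. f (- x + 1 / N n * t) * (of_real (N n) * gaussian (of_real ((N n)\<^sup>2)) (- x + 1 / N n * t + x)) \<partial>lborel)"
      using N[of n] by (intro lborel_integral_real_affine) simp
    also have "(\<lambda>t. f (- x + 1 / N n * t) * (of_real (N n) * gaussian (of_real ((N n)\<^sup>2)) (- x + 1 / N n * t + x)))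
        = (\<lambda>t. of_real (N n) * (f (- x + 1 / N n * t) * gaussian 1 t))"
    proof
      fix t
      have "gaussian (of_real ((N n)\<^sup>2)) (- x + 1 / N n * t + x) = gaussian 1 t"
        using N[of n] by (simp add: gaussian_def power_divide)
      then show "f (- x + 1 / N n * t) * (of_real (N n) * gaussian (of_real ((N n)\<^sup>2)) (- x + 1 / N n * t + x))
        = of_real (N n) * (f (- x + 1 / N n * t) * gaussian 1 t)" by (simp only: mult_ac)
    qed
    also have "\<bar>1 / N n\<bar> *\<^sub>R (\<integral>t. of_real (N n) * (f (- x + 1 / N n * t) * gaussian 1 t) \<partial>lborel)
        = (\<integral>t. f (- x + 1 / N n * t) * gaussian 1 t \<partial>lborel)"
      using N[of n] by (simp add: scaleR_conv_of_real)
    finally show ?thesis .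
  qed
  moreover have "(\<lambda>n. \<integral>t. f (- x + 1 / N n * t) * gaussian 1 t \<partial>lborel) \<longlonglongrightarrow> (\<integral>t. f (- x) * gaussian 1 t \<partial>lborel)"
  proof -
    obtain C where C: "\<And>x. cmod (f x) \<le> C" using decayingE_bounded[OF f] by metis
    have g: "decaying (gaussian 1)" by (rule gaussian_decaying) simp
    have [measurable]: "gaussian 1 \<in> borel_measurable borel" "f \<in> borel_measurable borel"
      using decaying_borel g f by auto
    show ?thesis
    proof (rule integral_dominated_convergence[where w = "\<lambda>t. C * cmod (gaussian 1 t)"])
      show "integrable lborel (\<lambda>t. C * cmod (gaussian 1 t))"
        using decaying_integrable[OF g] by (intro integrable_mult_right integrable_norm)
      have "(\<lambda>n. f (- x + 1 / N n * t)) \<longlonglongrightarrow> f (- x)" for t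
      proof (rule isCont_tendsto_compose[of _ f])
        show "isCont f (- x)" using decaying_continuous[OF f] by (simp add: continuous_on_eq_continuous_at)
        show "(\<lambda>n. - x + 1 / N n * t) \<longlonglongrightarrow> - x"
          using tendsto_add[OF tendsto_const tendsto_mult[OF N_lim tendsto_const], of "- x" t] by simp
      qed
      then show "AE t in lborel. (\<lambda>n. f (- x + 1 / N n * t) * gaussian 1 t) \<longlonglongrightarrow> f (- x) * gaussian 1 t"
        by (intro AE_I2 tendsto_intros)
      show "AE t in lborel. cmod (f (- x + 1 / N n * t) * gaussian 1 t) \<le> C * cmod (gaussian 1 t)" for n
        using C by (intro AE_I2) (simp add: norm_mult mult_right_mono)
      show "(\<lambda>t. f (- x + 1 / N n * t) * gaussian 1 t) \<in> borel_measurable lborel" for n by measurable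
      show "(\<lambda>t. f (- x) * gaussian 1 t) \<in> borel_measurable lborel" by measurable
    qed
  qed
  moreover have "(\<integral>t. gaussian 1 t \<partial>lborel) = 1"
  proof -
    have "(\<integral>t. complex_of_real (exp (- pi * 1 * t\<^sup>2)) \<partial>lborel) = of_real (1 / sqrt 1)"
      by (simp only: integral_complex_of_real integral_gaussian)
    then show ?thesis using gaussian_of_real[of 1] by simp
  qed
  ultimately have "I \<longlonglongrightarrow> f (- x) * 1" unfolding I_eq[abs_def] by simp
  with \<open>I \<longlonglongrightarrow> fourier (fourier f) x\<close> show ?thesis by (simp add: LIMSEQ_unique)
qed

text \<open>If the transform vanished identically, so would its own transform, against inversion.
  This keeps the denominators of the quotient away from 0.\<close>

lemma fourier_nonzero:
  assumes "decaying f" "decaying (fourier f)" "f x \<noteq> 0"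
  obtains \<xi> where "fourier f \<xi> \<noteq> 0"
proof -
  have "fourier (fourier f) (- x) \<noteq> 0" using fourier_inversion[OF assms(1,2)] assms(3) by simp
  then have "\<exists>\<xi>. fourier f \<xi> \<noteq> 0" unfolding fourier_def[of "fourier f"] by (auto intro: ccontr)
  then show ?thesis using that by blast
qed

section \<open>Inequalities between Lebesgue norms and the bound F \<ge> 1\<close>

lemma Lnorm_fourier_fourier:
  assumes "decaying f" "decaying (fourier f)"
  shows "Lnorm r (fourier (fourier f)) = Lnorm r f"
  using lborel_integral_real_affine[of "- 1" "\<lambda>x. cmod (f x) powr r" 0]
  unfolding Lnorm_def fourier_inversion[OF assms] by simp

text \<open>Hausdorff-Young for \<open>fourier f\<close>, whose transform is the reflection of
  \<open>f\<close> and has the same norms.\<close>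

lemma dual_hausdorff_young:
  assumes f: "decaying f" and F: "decaying (fourier f)" and q: "1 < q" "q \<le> 2"
  shows "Lnorm (q / (q - 1)) f \<le> Lnorm q (fourier f)"
proof -
  obtain C where C: "\<And>x. cmod (f x) \<le> C / (1 + x\<^sup>2)" using decayingE[OF f] by metis
  have "decaying (\<lambda>x. f (- x))"
  proof (rule decayingI)
    show "continuous_on UNIV (\<lambda>x. f (- x))"
      using continuous_on_compose2[OF decaying_continuous[OF f]] continuous_on_minus[OF continuous_on_id] by blast
    show "cmod (f (- x)) \<le> C / (1 + x\<^sup>2)" for x using C[of "- x"] by simp
  qed
  moreover have "fourier (fourier f) = (\<lambda>x. f (- x))" using fourier_inversion[OF f F] by auto
  ultimately have "Lnorm (q / (q - 1)) (fourier (fourier f)) \<le> Lnorm q (fourier f)"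
    using hausdorff_young[OF F _ q] by simp
  then show ?thesis by (simp only: Lnorm_fourier_fourier[OF f F])
qed

text \<open>Lyapunov's inequality, obtained by integrating the weighted arithmetic-geometric mean
  inequality. The exponents themselves, not their reciprocals, are interpolated, so the weights on
  the norms are \<theta>r/p and (1 - \<theta>)r'/p, which sum to 1.\<close>

lemma Lnorm_interpolation:
  assumes f: "decaying f" and nz: "f x0 \<noteq> 0" and r: "1 \<le> r" "1 \<le> r'" "0 < p"
    and \<theta>: "0 \<le> \<theta>" "\<theta> \<le> 1" "p = \<theta> * r + (1 - \<theta>) * r'"
  shows "Lnorm p f \<le> Lnorm r f powr (\<theta> * r / p) * Lnorm r' f powr ((1 - \<theta>) * r' / p)"
proof -
  define A where "A = (\<integral>x. cmod (f x) powr r \<partial>lborel)"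
  define B where "B = (\<integral>x. cmod (f x) powr r' \<partial>lborel)"
  have A: "A > 0" unfolding A_def by (rule integral_powr_pos[OF f r(1) nz])
  have B: "B > 0" unfolding B_def by (rule integral_powr_pos[OF f r(2) nz])
  \<comment> \<open>After division by \<open>A\<close> and \<open>B\<close> the two integrands have
    mass 1, so their weighted mean integrates to 1 and \<open>D\<close> is the whole bound.\<close>
  define D where "D = A powr \<theta> * B powr (1 - \<theta>)"
  have iA: "integrable lborel (\<lambda>x. cmod (f x) powr r)" and iB: "integrable lborel (\<lambda>x. cmod (f x) powr r')"
    using decaying_powr_integrable[OF f] r by auto
  have "(\<integral>x. cmod (f x) powr p \<partial>lborel) \<le> (\<integral>x. D * (\<theta> * (cmod (f x) powr r / A) + (1 - \<theta>) * (cmod (f x) powr r' / B)) \<partial>lborel)"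
  proof (rule integral_mono_AE')
    show "integrable lborel (\<lambda>x. D * (\<theta> * (cmod (f x) powr r / A) + (1 - \<theta>) * (cmod (f x) powr r' / B)))"
      by (intro integrable_mult_right Bochner_Integration.integrable_add integrable_divide iA iB)
    show "AE x in lborel. cmod (f x) powr p \<le> D * (\<theta> * (cmod (f x) powr r / A) + (1 - \<theta>) * (cmod (f x) powr r' / B))"
    proof (rule AE_I2)
      fix x
      show "cmod (f x) powr p \<le> D * (\<theta> * (cmod (f x) powr r / A) + (1 - \<theta>) * (cmod (f x) powr r' / B))"
      proof (cases "f x = 0")
        case False
        have "cmod (f x) powr p = (cmod (f x) powr r) powr \<theta> * (cmod (f x) powr r') powr (1 - \<theta>)"
          using False by (simp add: powr_powr \<theta>(3) mult.commute flip: powr_add)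
        also have "\<dots> = D * ((cmod (f x) powr r / A) powr \<theta> * (cmod (f x) powr r' / B) powr (1 - \<theta>))"
          using A B by (simp add: D_def powr_divide)
        also have "\<dots> \<le> D * (\<theta> * (cmod (f x) powr r / A) + (1 - \<theta>) * (cmod (f x) powr r' / B))"
          using A B False \<theta> by (intro mult_left_mono Youngs_inequality_0) (auto simp: D_def)
        finally show ?thesis .
      qed (use A B in simp)
    qed
  qed (use A B \<theta> in \<open>auto intro!: AE_I2 mult_nonneg_nonneg add_nonneg_nonneg divide_nonneg_pos simp: D_def\<close>)
  also have "\<dots> = D * (\<theta> * (A / A) + (1 - \<theta>) * (B / B))"
    using iA iB by (simp add: A_def B_def)
  also have "\<dots> = D" using A B by simp
  finally have "(\<integral>x. cmod (f x) powr p \<partial>lborel) powr (1 / p) \<le> D powr (1 / p)"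
    using r by (intro powr_mono2) auto
  also have "D powr (1 / p) = Lnorm r f powr (\<theta> * r / p) * Lnorm r' f powr ((1 - \<theta>) * r' / p)"
    using A B r unfolding D_def Lnorm_def A_def[symmetric] B_def[symmetric]
    by (simp add: powr_mult powr_powr)
  finally show ?thesis by (simp add: Lnorm_def)
qed

text \<open>With \<open>X\<close> and \<open>Y\<close> the L^q norms of \<open>f\<close> and its
  transform, the two p-norms are at most X^\<alpha> Y^\<beta> and Y^\<alpha> X^\<beta>. Since
  \<open>\<alpha> + \<beta> = 1\<close>, the product of these bounds is X Y.\<close>

lemma norm_quotient_ge_1:
  assumes f: "decaying f" and F: "decaying (fourier f)" and nz: "f x0 \<noteq> 0"
    and pq: "1 < q" "q < p" "1 \<le> 1 / p + 1 / q"
  shows "1 \<le> norm_quotient q p f"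
proof -
  define q' where "q' = q / (q - 1)"
  have inv: "1 / q' = 1 - 1 / q" using pq by (simp add: q'_def field_simps)
  have "1 / p < 1 / q" using pq by (simp add: frac_less2)
  then have "1 / 2 < 1 / q" using pq(3) by linarith
  then have q2: "q \<le> 2" using pq by (simp add: field_simps)
  have "0 < q'" using pq by (simp add: q'_def)
  have "1 / q' \<le> 1 / p" using pq(3) unfolding inv by linarith
  then have pq': "p \<le> q'" using \<open>0 < q'\<close> pq by (simp add: field_simps)
  \<comment> \<open>The weight placing \<open>p\<close> between \<open>q\<close> and
    \<open>q'\<close>; the denominator is positive because q < p \<le> q'.\<close>
  define \<theta> where "\<theta> = (q' - p) / (q' - q)"
  have \<theta>: "0 \<le> \<theta>" "\<theta> \<le> 1" "p = \<theta> * q + (1 - \<theta>) * q'"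
  proof -
    have d: "q' - q > 0" using pq pq' by simp
    show "0 \<le> \<theta>" "\<theta> \<le> 1" using d pq pq' by (simp_all add: \<theta>_def)
    have "\<theta> * (q' - q) = q' - p" using d by (simp add: \<theta>_def)
    then show "p = \<theta> * q + (1 - \<theta>) * q'" by (simp add: algebra_simps)
  qed
  define \<alpha> where "\<alpha> = \<theta> * q / p"
  define \<beta> where "\<beta> = (1 - \<theta>) * q' / p"
  have \<alpha>\<beta>: "\<alpha> + \<beta> = 1" "0 \<le> \<beta>"
  proof -
    have "\<alpha> + \<beta> = p / p" unfolding \<alpha>_def \<beta>_def by (subst (3) \<theta>(3)) (simp add: add_divide_distrib)
    then show "\<alpha> + \<beta> = 1" using pq by simp
    show "0 \<le> \<beta>" unfolding \<beta>_def using \<theta> pq \<open>0 < q'\<close> by simp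
  qed
  obtain \<xi> where \<xi>: "fourier f \<xi> \<noteq> 0" using fourier_nonzero[OF f F nz] .
  define X where "X = Lnorm q f"
  define Y where "Y = Lnorm q (fourier f)"
  have pos: "X > 0" "Y > 0" "Lnorm p f > 0" "Lnorm p (fourier f) > 0"
    using Lnorm_pos[OF f _ nz] Lnorm_pos[OF F _ \<xi>] pq by (auto simp: X_def Y_def)
  have "Lnorm p f \<le> X powr \<alpha> * Lnorm q' f powr \<beta>"
    unfolding X_def \<alpha>_def \<beta>_def using pq pq' \<theta> by (intro Lnorm_interpolation[OF f nz]) auto
  also have "\<dots> \<le> X powr \<alpha> * Y powr \<beta>"
    using dual_hausdorff_young[OF f F pq(1) q2] \<alpha>\<beta>(2)
    by (intro mult_left_mono powr_mono2) (auto simp: Y_def q'_def Lnorm_def)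
  finally have 1: "Lnorm p f \<le> X powr \<alpha> * Y powr \<beta>" .
  have "Lnorm p (fourier f) \<le> Y powr \<alpha> * Lnorm q' (fourier f) powr \<beta>"
    unfolding Y_def \<alpha>_def \<beta>_def using pq pq' \<theta> by (intro Lnorm_interpolation[OF F \<xi>]) auto
  also have "\<dots> \<le> Y powr \<alpha> * X powr \<beta>"
    using hausdorff_young[OF f F pq(1) q2] \<alpha>\<beta>(2)
    by (intro mult_left_mono powr_mono2) (auto simp: X_def q'_def Lnorm_def)
  finally have 2: "Lnorm p (fourier f) \<le> Y powr \<alpha> * X powr \<beta>" .
  have "Lnorm p f * Lnorm p (fourier f) \<le> (X powr \<alpha> * Y powr \<beta>) * (Y powr \<alpha> * X powr \<beta>)"
    using pos by (intro mult_mono 1 2) auto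
  also have "\<dots> = X powr (\<alpha> + \<beta>) * Y powr (\<alpha> + \<beta>)" by (simp only: powr_add mult_ac)
  also have "\<dots> = X * Y" using pos by (simp add: \<alpha>\<beta>)
  finally show ?thesis using pos unfolding norm_quotient_def X_def Y_def by simp
qed

section \<open>The image of the norm quotient\<close>

lemma Lnorm_cmult:
  assumes "r > 0"
  shows "Lnorm r (\<lambda>x. c * f x) = cmod c * Lnorm r f"
  using assms unfolding Lnorm_def norm_mult
  by (simp add: powr_mult powr_powr)

lemma fourier_cmult: "decaying f \<Longrightarrow> fourier (\<lambda>x. c * f x) = (\<lambda>\<xi>. c * fourier f \<xi>)"
  using fourier_combination[of f f c 0] by simp

lemma norm_quotient_cmult:
  assumes "decaying f" "c \<noteq> 0" "p > 0" "q > 0"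
  shows "norm_quotient q p (\<lambda>x. c * f x) = norm_quotient q p f"
  using assms(2-) unfolding norm_quotient_def fourier_cmult[OF assms(1)] by (simp add: Lnorm_cmult)

text \<open>On the segment all functions are dominated by |u| + |v|, so the integrals depend
  continuously on \<open>t\<close>.\<close>

lemma Lnorm_segment_continuous:
  assumes u: "decaying u" and v: "decaying v" and r: "r \<ge> 1"
  shows "continuous_on {0..1} (\<lambda>t. Lnorm r (\<lambda>x. of_real (1 - t) * u x + of_real t * v x))"
proof -
  define w where "w x = complex_of_real (cmod (u x) + cmod (v x))" for x
  define g where "g t x = of_real (1 - t) * u x + of_real t * v x" for t x
  have w: "decaying w"
  proof -
    have "decaying (\<lambda>x. of_real (cmod (u x)))" "decaying (\<lambda>x. of_real (cmod (v x)))"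
      by (rule decaying_dominated[OF u, of _ 1] decaying_dominated[OF v, of _ 1];
          auto intro!: continuous_intros decaying_continuous[OF u] decaying_continuous[OF v])+
    from decaying_add[OF this] show ?thesis by (simp add: w_def[abs_def])
  qed
  have g: "decaying (g t)" for t
    unfolding g_def by (intro decaying_add decaying_cmult u v)
  have gw: "cmod (g t x) \<le> cmod (w x)" if "t \<in> {0..1}" for t x
  proof -
    have "cmod (g t x) \<le> cmod (of_real (1 - t) * u x) + cmod (of_real t * v x)"
      unfolding g_def by (rule norm_triangle_ineq)
    also have "\<dots> = \<bar>1 - t\<bar> * cmod (u x) + \<bar>t\<bar> * cmod (v x)"
      by (simp only: norm_mult norm_of_real)
    also have "\<dots> \<le> 1 * cmod (u x) + 1 * cmod (v x)"
      using that by (intro add_mono mult_right_mono) auto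
    also have "\<dots> = cmod (w x)" unfolding w_def norm_of_real by simp
    finally show ?thesis .
  qed
  have "continuous_on {0..1} (\<lambda>t. \<integral>x. cmod (g t x) powr r \<partial>lborel)"
    unfolding continuous_on_sequentially comp_def
  proof safe
    fix X :: "nat \<Rightarrow> real" and a assume X: "\<forall>n. X n \<in> {0..1}" "X \<longlonglongrightarrow> a"
    show "(\<lambda>n. \<integral>x. cmod (g (X n) x) powr r \<partial>lborel) \<longlonglongrightarrow> (\<integral>x. cmod (g a x) powr r \<partial>lborel)"
    proof (rule integral_dominated_convergence[where w = "\<lambda>x. cmod (w x) powr r"])
      show "integrable lborel (\<lambda>x. cmod (w x) powr r)" by (rule decaying_powr_integrable[OF w r])
      show "(\<lambda>x. cmod (g t x) powr r) \<in> borel_measurable lborel" for t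
        using decaying_powr_integrable[OF g r] by (rule borel_measurable_integrable)
      then show "(\<lambda>x. cmod (g (X n) x) powr r) \<in> borel_measurable lborel" for n .
      show "AE x in lborel. (\<lambda>n. cmod (g (X n) x) powr r) \<longlonglongrightarrow> cmod (g a x) powr r"
        unfolding g_def using r X(2) by (intro AE_I2 tendsto_powr' tendsto_intros) auto
      show "AE x in lborel. norm (cmod (g (X n) x) powr r) \<le> cmod (w x) powr r" for n
        using gw X(1) r by (intro AE_I2) (auto intro!: powr_mono2)
    qed
  qed
  then show ?thesis
    unfolding Lnorm_def g_def using r by (intro continuous_on_powr' continuous_intros) auto
qed

lemma schwartz_norm_pos:
  assumes f: "f \<in> schwartz_space - {\<lambda>_. 0}" and r: "r \<ge> 1"
  shows "0 < Lnorm r f" "0 < Lnorm r (fourier f)"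
proof -
  obtain x where x: "f x \<noteq> 0" using f by auto
  have d: "decaying f" "decaying (fourier f)"
    using f by (auto intro: schwartz_decaying fourier_schwartz_decaying)
  obtain \<xi> where "fourier f \<xi> \<noteq> 0" using fourier_nonzero[OF d x] .
  then show "0 < Lnorm r f" "0 < Lnorm r (fourier f)" using Lnorm_pos d x r by blast+
qed

text \<open>The intermediate value theorem along the segment from \<open>f\<close> to
  \<open>g\<close>. Should the segment meet 0, then \<open>g\<close> is a multiple of
  \<open>f\<close>; both quotients coincide by homogeneity and \<open>y\<close> is their common
  value.\<close>

lemma norm_quotient_image_interval:
  assumes pq: "1 \<le> q" "1 \<le> p"
  shows "is_interval (norm_quotient q p ` (schwartz_space - {\<lambda>_. 0}))" (is "is_interval (_ ` ?S)")
  unfolding is_interval_1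
proof (intro ballI allI impI)
  fix a b y
  assume "a \<in> norm_quotient q p ` ?S" "b \<in> norm_quotient q p ` ?S" "a \<le> y \<and> y \<le> b"
  then obtain f g where f: "f \<in> schwartz_space" "f \<noteq> (\<lambda>_. 0)"
    and g: "g \<in> schwartz_space" "g \<noteq> (\<lambda>_. 0)"
    and y: "norm_quotient q p f \<le> y" "y \<le> norm_quotient q p g" by auto
  note df = schwartz_decaying[OF f(1)] fourier_schwartz_decaying[OF f(1)]
  note dg = schwartz_decaying[OF g(1)] fourier_schwartz_decaying[OF g(1)]
  define h where "h t x = of_real (1 - t) * f x + of_real t * g x" for t x
  have hS: "h t \<in> schwartz_space" for t
    unfolding h_def by (rule schwartz_combination[OF f(1) g(1)])
  have hF: "fourier (h t) = (\<lambda>\<xi>. of_real (1 - t) * fourier f \<xi> + of_real t * fourier g \<xi>)" for t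
    unfolding h_def by (rule fourier_combination[OF df(1) dg(1)])
  have h01: "h 0 = f" "h 1 = g" by (auto simp: h_def)
  show "y \<in> norm_quotient q p ` ?S"
  proof (cases "\<exists>t\<in>{0..1}. h t = (\<lambda>_. 0)")
    case True
    then obtain t where t: "t \<in> {0..1}" "h t = (\<lambda>_. 0)" by blast
    then have "t \<noteq> 0" "t \<noteq> 1" using h01 f g by auto
    define c :: complex where "c = - of_real ((1 - t) / t)"
    have "c \<noteq> 0" using \<open>t \<noteq> 0\<close> \<open>t \<noteq> 1\<close> by (simp add: c_def)
    have "of_real t * c = - complex_of_real (t * ((1 - t) / t))"
      by (simp only: c_def of_real_mult mult_minus_right)
    then have tc: "of_real t * c = - complex_of_real (1 - t)" using \<open>t \<noteq> 0\<close> by simp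
    have "g = (\<lambda>x. c * f x)"
    proof
      fix x
      have "of_real (1 - t) * f x + of_real t * g x = 0" using fun_cong[OF t(2), of x] by (simp add: h_def)
      then have "of_real t * g x = - (of_real (1 - t) * f x)" by (simp add: eq_neg_iff_add_eq_0 add.commute)
      also have "\<dots> = of_real t * (c * f x)" by (simp only: mult.assoc[symmetric] tc mult_minus_left)
      finally show "g x = c * f x" using \<open>t \<noteq> 0\<close> by simp
    qed
    then have "norm_quotient q p g = norm_quotient q p f"
      using norm_quotient_cmult[OF df(1) \<open>c \<noteq> 0\<close>] pq by simp
    then have "y = norm_quotient q p f" using y by simp
    then show ?thesis using f by blast
  next
    case False
    then have hn: "h t \<in> ?S" if "t \<in> {0..1}" for t using hS that by blast
    have "continuous_on {0..1} (\<lambda>t. norm_quotient q p (h t))"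
      unfolding norm_quotient_def
    proof (intro continuous_intros)
      show "continuous_on {0..1} (\<lambda>t. Lnorm q (h t))" "continuous_on {0..1} (\<lambda>t. Lnorm p (h t))"
        unfolding h_def using pq by (intro Lnorm_segment_continuous df dg; simp)+
      show "continuous_on {0..1} (\<lambda>t. Lnorm q (fourier (h t)))" "continuous_on {0..1} (\<lambda>t. Lnorm p (fourier (h t)))"
        unfolding hF using pq by (intro Lnorm_segment_continuous df dg; simp)+
      show "\<forall>t\<in>{0..1}. Lnorm p (h t) * Lnorm p (fourier (h t)) \<noteq> 0"
        using schwartz_norm_pos[OF hn pq(2)] by (metis mult_eq_0_iff less_irrefl)
    qed
    then obtain t where "0 \<le> t" "t \<le> 1" "norm_quotient q p (h t) = y"
      using IVT'[of "\<lambda>t. norm_quotient q p (h t)" 0 y 1] y by (auto simp: h01)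
    then show ?thesis using hn[of t] by auto
  qed
qed

section \<open>Gaussian test functions with large and small quotient\<close>

lemma Lnorm_gaussian:
  assumes "Re a > 0" "r > 0"
  shows "Lnorm r (gaussian a) = (r * Re a) powr (- 1 / (2 * r))"
proof -
  have "cmod (gaussian a x) powr r = exp (- pi * (r * Re a) * x\<^sup>2)" for x
    by (simp add: norm_gaussian powr_def mult_ac)
  then have "Lnorm r (gaussian a) = (1 / sqrt (r * Re a)) powr (1 / r)"
    unfolding Lnorm_def using integral_gaussian[of "r * Re a"] assms by simp
  also have "1 / sqrt (r * Re a) = (r * Re a) powr (- 1 / 2)"
    using assms by (simp add: powr_minus_divide powr_half_sqrt)
  finally show ?thesis by (simp add: powr_powr)
qed

lemma gaussian_nontrivial: "Re a > 0 \<Longrightarrow> gaussian a \<in> schwartz_space - {\<lambda>_. 0}"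
  using gaussian_schwartz gaussian_nonzero[of a 0] by auto

text \<open>The transform is a multiple of \<open>gaussian (1 / a)\<close>, and scalars cancel. The
  base \<open>Re a * Re (1 / a)\<close> is (Re a / |a|)^2, which is 1 for real \<open>a\<close> and
  becomes small only for strong chirps.\<close>

lemma norm_quotient_gaussian:
  assumes a: "Re a > 0" and pq: "1 \<le> q" "1 \<le> p"
  shows "norm_quotient q p (gaussian a)
    = (q powr (- 1 / (2 * q)) / p powr (- 1 / (2 * p)))\<^sup>2 * (Re a * Re (1 / a)) powr (1 / (2 * p) - 1 / (2 * q))"
proof -
  define c where "c = fourier (gaussian a) 0"
  have F: "fourier (gaussian a) = (\<lambda>\<xi>. c * gaussian (1 / a) \<xi>)"
    unfolding c_def using fourier_gaussian[OF a] by blast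
  have c: "c \<noteq> 0"
    using schwartz_norm_pos(2)[OF gaussian_nontrivial[OF a] pq(1)] unfolding F by (auto simp: Lnorm_def)
  have a': "Re (1 / a) > 0"
  proof -
    have "a \<noteq> 0" using a by auto
    then have "(Re a)\<^sup>2 + (Im a)\<^sup>2 > 0" by (simp add: complex_neq_0)
    then show ?thesis using a by (simp add: Re_divide)
  qed
  have ratio: "Lnorm q (gaussian b) / Lnorm p (gaussian b)
      = (q powr (- 1 / (2 * q)) / p powr (- 1 / (2 * p))) * Re b powr (1 / (2 * p) - 1 / (2 * q))"
    if "Re b > 0" for b
  proof -
    have "1 / (2 * p) - 1 / (2 * q) = - 1 / (2 * q) - (- 1 / (2 * p))" by simp
    then show ?thesis using that pq by (simp only: powr_diff) (simp add: Lnorm_gaussian powr_mult)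
  qed
  have "norm_quotient q p (gaussian a) =
     (Lnorm q (gaussian a) / Lnorm p (gaussian a)) * (Lnorm q (gaussian (1 / a)) / Lnorm p (gaussian (1 / a)))"
    using c pq unfolding norm_quotient_def F by (simp add: Lnorm_cmult)
  also have "\<dots> = (q powr (- 1 / (2 * q)) / p powr (- 1 / (2 * p)))\<^sup>2 * (Re a powr (1 / (2 * p) - 1 / (2 * q)) * Re (1 / a) powr (1 / (2 * p) - 1 / (2 * q)))"
    unfolding ratio[OF a] ratio[OF a'] by (simp only: power2_eq_square mult_ac)
  finally show ?thesis using a a' by (simp add: powr_mult)
qed

text \<open>For a = s + i the base is s^2/(s^2 + 1) \<le> s^2, and the exponent
  \<open>- \<delta>\<close> is negative because q < p, so small \<open>s\<close> makes the quotient
  large.\<close>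

lemma norm_quotient_unbounded:
  assumes pq: "1 < q" "q < p"
  shows "\<not> bdd_above (norm_quotient q p ` (schwartz_space - {\<lambda>_. 0}))"
proof
  assume "bdd_above (norm_quotient q p ` (schwartz_space - {\<lambda>_. 0}))"
  then obtain M where M: "\<And>f. f \<in> schwartz_space - {\<lambda>_. 0} \<Longrightarrow> norm_quotient q p f \<le> M"
    unfolding bdd_above_def by blast
  define c where "c = (q powr (- 1 / (2 * q)) / p powr (- 1 / (2 * p)))\<^sup>2"
  define \<delta> where "\<delta> = 1 / (2 * q) - 1 / (2 * p)"
  have c: "c > 0" using pq by (simp add: c_def)
  have \<delta>: "\<delta> > 0" using pq by (simp add: \<delta>_def field_simps)
  define K where "K = (\<bar>M\<bar> + 1) / c"
  have K: "K > 0" using c by (simp add: K_def)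
  \<comment> \<open>Chosen so that (s^2)^(-\<delta>) = K, which makes the lower bound c K = |M| + 1
    exceed \<open>M\<close>.\<close>
  define s where "s = K powr (- 1 / (2 * \<delta>))"
  have s: "s > 0" using K by (simp add: s_def)
  let ?a = "Complex s 1"
  have "norm_quotient q p (gaussian ?a) = c * (Re ?a * Re (1 / ?a)) powr (- \<delta>)"
    using norm_quotient_gaussian[of ?a q p] pq s by (simp add: c_def \<delta>_def)
  also have "Re ?a * Re (1 / ?a) = s\<^sup>2 / (s\<^sup>2 + 1)"
    by (simp add: Re_divide power2_eq_square)
  finally have eq: "norm_quotient q p (gaussian ?a) = c * (s\<^sup>2 / (s\<^sup>2 + 1)) powr (- \<delta>)" .
  have "s\<^sup>2 / (s\<^sup>2 + 1) \<le> s\<^sup>2" using s by (simp add: divide_le_eq mult_le_cancel_left1 add_pos_pos)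
  then have "(s\<^sup>2) powr (- \<delta>) \<le> (s\<^sup>2 / (s\<^sup>2 + 1)) powr (- \<delta>)"
    using s \<delta> by (intro powr_mono2') (auto intro!: divide_pos_pos add_pos_pos)
  then have "c * (s\<^sup>2) powr (- \<delta>) \<le> norm_quotient q p (gaussian ?a)"
    unfolding eq using c by (intro mult_left_mono) auto
  also have "\<dots> \<le> M" using s by (intro M gaussian_nontrivial) simp
  also have "(s\<^sup>2) powr (- \<delta>) = K"
    using K \<delta> by (simp add: s_def powr_powr flip: powr_numeral)
  finally show False using c by (simp add: K_def)
qed

lemma integral_gaussian_powr:
  assumes "s > 0" "r > 0" "0 \<le> d"
  shows "integrable lborel (\<lambda>x. (d * exp (- pi * s * x\<^sup>2)) powr r)"
    and "(\<integral>x. (d * exp (- pi * s * x\<^sup>2)) powr r \<partial>lborel) = d powr r / sqrt (r * s)"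
proof -
  have eq: "(d * exp (- pi * s * x\<^sup>2)) powr r = d powr r * exp (- pi * (r * s) * x\<^sup>2)" for x
    using assms by (simp add: powr_mult) (simp add: powr_def mult_ac)
  show "integrable lborel (\<lambda>x. (d * exp (- pi * s * x\<^sup>2)) powr r)"
    using integrable_norm[OF decaying_integrable[OF gaussian_decaying[of "of_real (r * s)"]]] assms
    unfolding eq norm_gaussian by (intro integrable_mult_right) simp
  show "(\<integral>x. (d * exp (- pi * s * x\<^sup>2)) powr r \<partial>lborel) = d powr r / sqrt (r * s)"
    using integral_gaussian[of "r * s"] assms unfolding eq by simp
qed

text \<open>For a function equal to its own transform the quotient is the square of ||f||_q /
  ||f||_p. For the sum of a wide and a narrow Gaussian exchanged by the transform, this ratio is at
  most C s^(-\<eta>).\<close>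

lemma norm_quotient_arbitrarily_small:
  assumes pq: "1 < q" "q < p" "1 / p + 1 / q < 1" and y: "y > 0"
  shows "\<exists>f \<in> schwartz_space - {\<lambda>_. 0}. norm_quotient q p f < y"
proof -
  define \<kappa> where "\<kappa> = \<bar>1 / q - 1 / 2\<bar>"
  define \<eta> where "\<eta> = (1 / 2 - 1 / p) - \<kappa>"
  have p2: "p > 2"
  proof -
    have "1 / p < 1 / q" using pq by (simp add: frac_less2)
    then have "1 / p < 1 / 2" using pq(3) by linarith
    then show ?thesis using pq by (simp add: field_simps)
  qed
  \<comment> \<open>If 1/q \<ge> 1/2, then \<open>\<eta>\<close> is 1 - 1/p - 1/q; otherwise it is
    1/q - 1/p. Both are positive.\<close>
  have \<eta>: "\<eta> > 0"
  proof -
    have "1 / p < 1 / q" using pq by (simp add: frac_less2)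
    then show ?thesis unfolding \<eta>_def \<kappa>_def using pq(3) by linarith
  qed
  \<comment> \<open>Collects the constants of the upper bound for the q-norm and the lower bound for
    the p-norm.\<close>
  define C where "C = 2 * (2 / sqrt q) powr (1 / q) * sqrt p powr (1 / p)"
  have C: "C > 0" using pq by (simp add: C_def)
  \<comment> \<open>Makes s^\<eta> = 1 + C / sqrt y, hence C / s^\<eta> < sqrt y. The summand 1
    ensures s \<ge> 1, so that powers of \<open>s\<close> increase with the exponent.\<close>
  define s where "s = (1 + C / sqrt y) powr (1 / \<eta>)"
  have base1: "1 + C / sqrt y \<ge> 1" using C y by simp
  have s1: "s \<ge> 1" unfolding s_def using base1 \<eta> by (intro ge_one_powr_ge_zero) auto
  have s\<eta>: "s powr \<eta> = 1 + C / sqrt y" unfolding s_def using \<eta> base1 by (simp add: powr_powr)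
  have s0: "s > 0" using s1 by simp
  define u where "u x = (1 / sqrt s) * exp (- pi * (1 / s\<^sup>2) * x\<^sup>2)" for x
  define v where "v x = sqrt s * exp (- pi * s\<^sup>2 * x\<^sup>2)" for x
  define f where "f x = complex_of_real (u x + v x)" for x
  have uv: "u x > 0" "v x > 0" for x using s0 by (auto simp: u_def v_def)
  have f_norm: "cmod (f x) = u x + v x" for x
    unfolding f_def norm_of_real using uv[of x] by simp
  have f_eq: "f = (\<lambda>x. of_real (1 / sqrt s) * gaussian (of_real (1 / s\<^sup>2)) x + of_real (sqrt s) * gaussian (of_real (s\<^sup>2)) x)"
    unfolding f_def u_def v_def gaussian_of_real by simp
  have pos: "0 < 1 / s\<^sup>2" "0 < s\<^sup>2" using s0 by auto
  have G: "gaussian (of_real (1 / s\<^sup>2)) \<in> schwartz_space" "gaussian (of_real (s\<^sup>2)) \<in> schwartz_space"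
    using pos by (auto intro!: gaussian_schwartz simp only: Re_complex_of_real)
  have fS: "f \<in> schwartz_space" unfolding f_eq by (rule schwartz_combination[OF G])
  have "f 0 \<noteq> 0" using f_norm[of 0] uv[of 0] by (metis add_pos_pos less_irrefl norm_zero)
  then have fn: "f \<in> schwartz_space - {\<lambda>_. 0}" using fS by auto
  have "fourier f = f"
  proof
    fix \<xi>
    have rs: "1 / sqrt (1 / s\<^sup>2) = s" "1 / sqrt (s\<^sup>2) = 1 / s" "1 / (1 / s\<^sup>2) = s\<^sup>2"
      using s0 by (auto simp: real_sqrt_divide)
    have ss: "1 / sqrt s * s = sqrt s" "sqrt s * (1 / s) = 1 / sqrt s"
      using s0 by (simp_all add: real_div_sqrt field_simps)
    have "fourier f \<xi> = of_real (1 / sqrt s) * (of_real s * gaussian (of_real (s\<^sup>2)) \<xi>)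
        + of_real (sqrt s) * (of_real (1 / s) * gaussian (of_real (1 / s\<^sup>2)) \<xi>)"
      unfolding f_eq fourier_combination[OF schwartz_decaying[OF G(1)] schwartz_decaying[OF G(2)]]
        fourier_real_gaussian[OF pos(1)] fourier_real_gaussian[OF pos(2)] rs ..
    also have "\<dots> = of_real (1 / sqrt s * s) * gaussian (of_real (s\<^sup>2)) \<xi>
        + of_real (sqrt s * (1 / s)) * gaussian (of_real (1 / s\<^sup>2)) \<xi>"
      by (simp only: of_real_mult mult.assoc)
    also have "\<dots> = f \<xi>" unfolding ss f_eq by (simp only: add.commute)
    finally show "fourier f \<xi> = f \<xi>" .
  qed
  then have quot: "norm_quotient q p f = (Lnorm q f / Lnorm p f)\<^sup>2"
    unfolding norm_quotient_def by (simp add: power2_eq_square)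
  have u_int: "integrable lborel (\<lambda>x. u x powr r)" "(\<integral>x. u x powr r \<partial>lborel) = s powr (1 - r / 2) / sqrt r"
    and v_int: "integrable lborel (\<lambda>x. v x powr r)" "(\<integral>x. v x powr r \<partial>lborel) = s powr (r / 2 - 1) / sqrt r"
    if r: "r > 0" for r
  proof -
    note U = integral_gaussian_powr[OF pos(1) r, of "1 / sqrt s"]
    note V = integral_gaussian_powr[OF pos(2) r, of "sqrt s"]
    show "integrable lborel (\<lambda>x. u x powr r)" "integrable lborel (\<lambda>x. v x powr r)"
      using U(1) V(1) s0 unfolding u_def v_def by auto
    have "(1 / sqrt s) powr r / sqrt (r * (1 / s\<^sup>2)) = s * (1 / sqrt s) powr r / sqrt r"
      using s0 by (simp add: real_sqrt_divide real_sqrt_mult)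
    also have "s * (1 / sqrt s) powr r = s powr (1 - r / 2)"
      using s0 by (simp add: powr_diff powr_divide powr_half_sqrt[symmetric] powr_powr)
    finally show "(\<integral>x. u x powr r \<partial>lborel) = s powr (1 - r / 2) / sqrt r"
      using U(2) s0 unfolding u_def by simp
    have "sqrt s powr r / sqrt (r * s\<^sup>2) = sqrt s powr r / s / sqrt r"
      using s0 by (simp add: real_sqrt_mult)
    also have "sqrt s powr r / s = s powr (r / 2 - 1)"
      using s0 by (simp add: powr_diff powr_half_sqrt[symmetric] powr_powr)
    finally show "(\<integral>x. v x powr r \<partial>lborel) = s powr (r / 2 - 1) / sqrt r"
      using V(2) s0 unfolding v_def by simp
  qed
  have upper: "Lnorm q f \<le> 2 * (2 / sqrt q) powr (1 / q) * s powr \<kappa>"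
  proof -
    have q0: "q > 0" using pq by simp
    have "(\<integral>x. cmod (f x) powr q \<partial>lborel) \<le> (\<integral>x. 2 powr q * (u x powr q + v x powr q) \<partial>lborel)"
    proof (rule integral_mono)
      show "integrable lborel (\<lambda>x. cmod (f x) powr q)"
        using pq by (intro decaying_powr_integrable schwartz_decaying fS) simp
      show "integrable lborel (\<lambda>x. 2 powr q * (u x powr q + v x powr q))"
        by (intro integrable_mult_right Bochner_Integration.integrable_add u_int v_int q0)
      show "cmod (f x) powr q \<le> 2 powr q * (u x powr q + v x powr q)" for x
      proof -
        have "cmod (f x) powr q \<le> (2 * max (u x) (v x)) powr q"
          unfolding f_norm using uv[of x] pq by (intro powr_mono2) auto
        also have "\<dots> = 2 powr q * max (u x) (v x) powr q" using uv[of x] by (simp add: powr_mult)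
        also have "\<dots> \<le> 2 powr q * (u x powr q + v x powr q)"
          by (intro mult_left_mono) (auto simp: max_def)
        finally show ?thesis .
      qed
    qed
    also have "\<dots> = 2 powr q * (s powr (1 - q / 2) / sqrt q + s powr (q / 2 - 1) / sqrt q)"
      using u_int[OF q0] v_int[OF q0] by simp
    also have "\<dots> \<le> 2 powr q * (s powr (q * \<kappa>) / sqrt q + s powr (q * \<kappa>) / sqrt q)"
    proof -
      \<comment> \<open>The exponents for \<open>u\<close> and \<open>v\<close> are opposite numbers
        of absolute value \<open>q * \<kappa>\<close>, so this one exponent bounds both
        terms.\<close>
      have "q * \<kappa> = \<bar>q * (1 / q - 1 / 2)\<bar>" unfolding \<kappa>_def abs_mult using q0 by simp
      also have "q * (1 / q - 1 / 2) = 1 - q / 2" using q0 by (simp add: field_simps)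
      finally have "1 - q / 2 \<le> q * \<kappa>" "q / 2 - 1 \<le> q * \<kappa>" by auto
      then show ?thesis using s1 q0
        by (intro mult_left_mono add_mono divide_right_mono powr_mono) auto
    qed
    also have "\<dots> = 2 powr q * ((2 / sqrt q) * s powr (q * \<kappa>))" by simp
    finally have le: "(\<integral>x. cmod (f x) powr q \<partial>lborel) powr (1 / q) \<le> (2 powr q * ((2 / sqrt q) * s powr (q * \<kappa>))) powr (1 / q)"
      using q0 by (intro powr_mono2) auto
    have "(2 powr q * (b * s powr (q * \<kappa>))) powr (1 / q) = 2 * b powr (1 / q) * s powr \<kappa>" if "b > 0" for b
      using q0 s0 that by (simp add: powr_mult powr_powr)
    from this[of "2 / sqrt q"] have "(2 powr q * ((2 / sqrt q) * s powr (q * \<kappa>))) powr (1 / q) = 2 * (2 / sqrt q) powr (1 / q) * s powr \<kappa>"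
      using q0 by (simp only: divide_pos_pos zero_less_numeral real_sqrt_gt_zero)
    with le show ?thesis unfolding Lnorm_def by (simp only:)
  qed
  have lower: "s powr (1 / 2 - 1 / p) / sqrt p powr (1 / p) \<le> Lnorm p f"
  proof -
    have p0: "p > 0" using p2 by simp
    \<comment> \<open>Since p > 2, the narrow tall Gaussian \<open>v\<close> carries the main part
      of the p-norm; discarding \<open>u\<close> gives the lower bound.\<close>
    have "s powr (p / 2 - 1) / sqrt p \<le> (\<integral>x. cmod (f x) powr p \<partial>lborel)"
      unfolding v_int(2)[OF p0, symmetric]
    proof (rule integral_mono)
      show "integrable lborel (\<lambda>x. cmod (f x) powr p)"
        using p2 by (intro decaying_powr_integrable schwartz_decaying fS) simp
      show "v x powr p \<le> cmod (f x) powr p" for x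
        unfolding f_norm using uv[of x] p0 by (intro powr_mono2) auto
    qed (rule v_int(1)[OF p0])
    then have "(s powr (p / 2 - 1) / sqrt p) powr (1 / p) \<le> Lnorm p f"
      unfolding Lnorm_def using p0 by (intro powr_mono2) auto
    moreover have "(p / 2 - 1) * (1 / p) = 1 / 2 - 1 / p" using p0 by (simp add: field_simps)
    ultimately show ?thesis using p0 by (simp add: powr_divide powr_powr)
  qed
  have "Lnorm q f / Lnorm p f \<le> (2 * (2 / sqrt q) powr (1 / q) * s powr \<kappa>) / (s powr (1 / 2 - 1 / p) / sqrt p powr (1 / p))"
    using upper lower s0 p2 by (intro frac_le) auto
  also have "\<dots> = C * (s powr \<kappa> / s powr (1 / 2 - 1 / p))" by (simp add: C_def)
  also have "s powr \<kappa> / s powr (1 / 2 - 1 / p) = 1 / s powr \<eta>"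
    by (simp add: \<eta>_def powr_diff)
  also have "C * (1 / s powr \<eta>) < sqrt y"
  proof -
    have "C < sqrt y * (1 + C / sqrt y)" using y by (simp add: distrib_left)
    then show ?thesis unfolding s\<eta> using base1 by (simp add: divide_less_eq)
  qed
  finally have "Lnorm q f / Lnorm p f < sqrt y" .
  moreover have "0 \<le> Lnorm q f / Lnorm p f" by (simp add: Lnorm_def)
  ultimately have "(Lnorm q f / Lnorm p f)\<^sup>2 < (sqrt y)\<^sup>2" by (intro power_strict_mono) auto
  then show ?thesis using y by (intro bexI[OF _ fn]) (simp add: quot)
qed

theorem theorem1p2:
  fixes p q :: real
  assumes "1 < q" and "q < p"
  shows "(1 / p + 1 / q \<ge> 1 \<longrightarrow>
            is_interval (norm_quotient q p ` (schwartz_space - {\<lambda>_. 0})) \<and>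
            norm_quotient q p ` (schwartz_space - {\<lambda>_. 0}) \<subseteq> {1..} \<and>
            \<not> bdd_above (norm_quotient q p ` (schwartz_space - {\<lambda>_. 0}))) \<and>
         (1 / p + 1 / q < 1 \<longrightarrow>
            norm_quotient q p ` (schwartz_space - {\<lambda>_. 0}) = {0<..})"
    (is "(_ \<longrightarrow> is_interval ?I \<and> _ \<and> _) \<and> _")
proof (intro conjI impI)
  \<comment> \<open>The interval property and unboundedness serve the second case as well.\<close>
  show int: "is_interval ?I"
    using assms by (intro norm_quotient_image_interval) auto
  show unb: "\<not> bdd_above ?I"
    using assms by (rule norm_quotient_unbounded)
  show "?I \<subseteq> {1..}" if "1 / p + 1 / q \<ge> 1"
  proof
    fix y assume "y \<in> ?I"
    then obtain f x where f: "f \<in> schwartz_space" "f x \<noteq> 0" and y: "y = norm_quotient q p f" by auto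
    show "y \<in> {1..}"
      using norm_quotient_ge_1[OF schwartz_decaying[OF f(1)] fourier_schwartz_decaying[OF f(1)] f(2) assms that]
      by (simp add: y)
  qed
  show "?I = {0<..}" if lt: "1 / p + 1 / q < 1"
  proof
    show "?I \<subseteq> {0<..}"
    proof
      fix y assume "y \<in> ?I"
      then obtain f where f: "f \<in> schwartz_space - {\<lambda>_. 0}" and y: "y = norm_quotient q p f" by blast
      show "y \<in> {0<..}"
        using schwartz_norm_pos[OF f] assms unfolding y norm_quotient_def greaterThan_iff
        by (intro divide_pos_pos mult_pos_pos) auto
    qed
    \<comment> \<open>Each positive \<open>y\<close> lies between a small value and a large value of
      the quotient, and the image is an interval.\<close>
    show "{0<..} \<subseteq> ?I"
    proof
      fix y :: real assume "y \<in> {0<..}"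
      then obtain f where f: "f \<in> schwartz_space - {\<lambda>_. 0}" "norm_quotient q p f < y"
        using norm_quotient_arbitrarily_small[OF assms lt] by auto
      obtain z where z: "z \<in> ?I" "y \<le> z"
        using unb unfolding bdd_above_def by (meson linorder_linear)
      show "y \<in> ?I"
        using int z f unfolding is_interval_1 by (meson imageI less_imp_le)
    qed
  qed
qed

end
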